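(* Let $n\ge 2$, let $m\ge 2$ and let $T=\{E_1,E_2,\dots,E_m\}$ be a strongly independent system of equations in the unknowns $x_1,\dots,x_n$. Then $m\le |E_1|+|E_2|+2$, and there exist indices $1\le k<\ell\le n$ such that $m\le 2(|E_1|_{x_k}+|E_1|_{x_\ell})+2$. If moreover $T$ has a solution of rank $n-1$, then $m\le |E_1|+|E_2|+1$, and there exist indices $1\le k<\ell\le n$ such that $m\le 2(|E_1|_{x_k}+|E_1|_{x_\ell})+1$.
   Context: Unknowns $\Xi=\{x_1,\dots,x_n\}$. An equation is a pair $E=(u,v)$ of words $u,v\in\Xi^*$; $|E|=|u|+|v|$ and $|E|_{x}=|u|_x+|v|_x$, where $|w|_x$ is the number of occurrences of $x$ in $w$. A solution of a system of equations is a monoid morphism $h:\Xi^*\to\Sigma^*$ ($\Sigma=\{a_1,\dots,a_k\}$ a finite alphabet) with $h(u)=h(v)$ for every equation $(u,v)$ of the system. For such $h$ let $\gamma(h)_i=(|h(x_1)|_{a_i},\dots,|h(x_n)|_{a_i})\in\mathbb Q^n$ ($i=1,\dots,k$), let $\Gamma_h$ be the $\mathbb Q$-linear span of $\gamma(h)_1,\dots,\gamma(h)_k$, and define the rank of $h$ to be $\dim\Gamma_h$. A system $T$ of equations in $n$ unknowns is strongly independent if every proper subsystem of $T$ has a solution of rank $n-1$ that is not a solution of $T$. *)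

theory Defs
  imports Complex_Main "HOL-Library.Function_Algebras"
begin

text \<open>Unknowns are the elements of a finite type 'x (so n = card (UNIV :: 'x set)); words over the
unknowns are lists; an equation is a pair of words. Solutions map into words over an
alphabet of natural-number letters (any finite alphabet embeds into nat).\<close>

type_synonym 'x eqn = "'x list \<times> 'x list"

definition eq_len :: "'x eqn \<Rightarrow> nat" where
  "eq_len E = length (fst E) + length (snd E)"

definition eq_occ :: "'x eqn \<Rightarrow> 'x \<Rightarrow> nat" where
  "eq_occ E x = count_list (fst E) x + count_list (snd E) x"

definition morph :: "('x \<Rightarrow> 'a list) \<Rightarrow> 'x list \<Rightarrow> 'a list" where
  "morph h w = concat (map h w)"

definition is_solution :: "('x \<Rightarrow> 'a list) \<Rightarrow> 'x eqn set \<Rightarrow> bool" where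
  "is_solution h S \<longleftrightarrow> (\<forall>E\<in>S. morph h (fst E) = morph h (snd E))"

definition gamma :: "('x \<Rightarrow> 'a list) \<Rightarrow> 'a \<Rightarrow> ('x \<Rightarrow> rat)" where
  "gamma h a = (\<lambda>x. of_nat (count_list (h x) a))"

definition rat_scale :: "rat \<Rightarrow> ('x \<Rightarrow> rat) \<Rightarrow> ('x \<Rightarrow> rat)" where
  "rat_scale c v = (\<lambda>i. c * v i)"

text \<open>Rank: dimension of the Q-span of the vectors gamma h a over all letters a
(letters not occurring in any image give the zero vector, which does not change the span).\<close>
definition rank :: "('x::finite \<Rightarrow> 'a list) \<Rightarrow> nat" where
  "rank h = vector_space.dim rat_scale (range (gamma h))"

definition strongly_independent :: "'x::finite eqn set \<Rightarrow> bool" where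
  "strongly_independent T \<longleftrightarrow>
     (\<forall>S. S \<subset> T \<longrightarrow> (\<exists>h :: 'x \<Rightarrow> nat list.
        is_solution h S \<and> rank h = card (UNIV :: 'x set) - 1 \<and> \<not> is_solution h T))"

end

theory Submission
  imports "HOL-Analysis.Analysis" Defs
begin

text \<open>
  Fix a solution \<open>h\<close> of rank \<open>n - 1\<close>. Give the letters real weights and let \<open>L\<close> be the induced weights of the
  unknowns; these \<open>L\<close> form a hyperplane \<open>V\<close>. For an equation \<open>E\<close> and an unknown \<open>x\<close> let \<open>Q E x L\<close> be the
  signed sum of \<open>exp\<close> of the weights of the prefixes in front of the occurrences of \<open>x\<close>. If \<open>h\<close> solves \<open>E\<close>,
  then the vector \<open>Q E\<close> is orthogonal to \<open>n - 1\<close> independent vectors, so two equations solved by \<open>h\<close> have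
  parallel vectors on \<open>V\<close>, that is, the minors of \<open>Q E1\<close> and \<open>Q E2\<close> vanish on \<open>V\<close>. Conversely, a nontrivial
  \<open>E1\<close> has \<open>Q E1 \<noteq> 0\<close> on \<open>V\<close>, so if the minors vanish on \<open>V\<close>, then \<open>E2\<close> inherits the solutions of \<open>E1\<close>
  belonging to \<open>V\<close>. Strong independence therefore yields pairwise distinct hyperplanes, one for each
  equation except \<open>E1\<close> and \<open>E2\<close>, on which all minors of \<open>E1\<close> and \<open>E2\<close> vanish although some minor is not
  identically zero.

  Such a minor is a sum of terms \<open>\<plusminus> exp (f \<bullet> L)\<close>. On a hyperplane where it vanishes no exponent \<open>f\<close> is the
  unique minimizer of \<open>f \<bullet> L\<close>, hence \<open>N\<close> hyperplanes meeting the positive orthant force \<open>N + 1\<close> exponents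
  that are minimal somewhere in the orthant. In a chain of exponents for the componentwise order only the
  least one can be minimal, and the exponents of the minor are covered by two chains (one for each side of
  \<open>E2\<close>) for every occurrence of \<open>k\<close> or \<open>l\<close> in \<open>E1\<close>. The hyperplanes that miss the positive orthant come
  from solutions erasing an unknown; there are at most two of them.
\<close>

section \<open>Regions of hyperplane arrangements\<close>

text \<open>Finitely many hyperplanes form a null set, which cannot cover a nonempty open
  set.\<close>

lemma exists_generic_point:
  fixes U B :: "'v::euclidean_space set"
  assumes "open U" "U \<noteq> {}" "finite B" "0 \<notin> B"
  shows "\<exists>p\<in>U. \<forall>b\<in>B. b \<bullet> p \<noteq> 0"
proof (rule ccontr)
  assume "\<not> ?thesis"
  then have sub: "U \<subseteq> (\<Union>b\<in>B. {x. b \<bullet> x = 0})" by auto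
  have "negligible (\<Union>b\<in>B. {x. b \<bullet> x = 0})"
    using assms(3,4) by (intro negligible_Union) (auto intro!: negligible_hyperplane)
  then have "negligible U" using sub negligible_subset by blast
  then show False using open_not_negligible assms(1,2) by blast
qed

lemma hyperplane_in_multiple:
  fixes a b :: "'v::real_inner"
  assumes "b = c *\<^sub>R a" "b \<noteq> 0"
  shows "{L. a \<bullet> L = 0} = {L. b \<bullet> L = 0}"
  using assms by auto

text \<open>The points represent the regions into which the hyperplanes cut the open set. A new
hyperplane \<^term>\<open>a\<close> splits the region around a generic point of it, so one old point is replaced by
two points on either side.\<close>

lemma exists_separated_points:
  fixes A B O' :: "'v::euclidean_space set"
  assumes "finite A" "open O'" "O' \<noteq> {}" "finite B" "0 \<notin> B"
    and "\<And>a. a \<in> A \<Longrightarrow> a \<noteq> 0 \<and> (\<exists>p\<in>O'. a \<bullet> p = 0)"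
    and "inj_on (\<lambda>a. {L. a \<bullet> L = 0}) A"
  shows "\<exists>P. finite P \<and> P \<subseteq> O' \<and> card P = card A + 1 \<and> (\<forall>p\<in>P. \<forall>b\<in>B. b \<bullet> p \<noteq> 0)
     \<and> (\<forall>p\<in>P. \<forall>q\<in>P. p \<noteq> q \<longrightarrow> (\<exists>a\<in>A. (a \<bullet> p) * (a \<bullet> q) < 0))"
  using assms(1,6,7)
proof (induction A)
  case empty
  obtain p where "p \<in> O'" "\<forall>b\<in>B. b \<bullet> p \<noteq> 0"
    using exists_generic_point[OF assms(2-5)] by auto
  then show ?case by (intro exI[of _ "{p}"]) auto
next
  case (insert a A)
  obtain P where P: "finite P" "P \<subseteq> O'" "card P = card A + 1" "\<forall>p\<in>P. \<forall>b\<in>B. b \<bullet> p \<noteq> 0"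
    "\<And>p q. p \<in> P \<Longrightarrow> q \<in> P \<Longrightarrow> p \<noteq> q \<Longrightarrow> \<exists>a\<in>A. (a \<bullet> p) * (a \<bullet> q) < 0"
    using insert by (auto simp: inj_on_insert)
  have a0: "a \<noteq> 0" using insert by auto
  obtain p0 where p0: "p0 \<in> O'" "a \<bullet> p0 = 0" using insert.prems(1)[of a] by auto
  \<comment> \<open>\<open>pr\<close> is the orthogonal projection onto the hyperplane of
    \<open>a\<close>. It is self-adjoint (\<open>bpr\<close>), so projecting a point that is generic
    for the projected normals gives a point of this hyperplane on none of the old ones.\<close>
  define pr where "pr x = x - ((a \<bullet> x) / (a \<bullet> a)) *\<^sub>R a" for x
  have apr: "a \<bullet> pr x = 0" for x using a0 by (simp add: pr_def inner_diff_right)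
  have bpr: "b \<bullet> pr x = pr b \<bullet> x" for b x
    by (simp add: pr_def inner_diff_right inner_diff_left inner_commute)
  have "continuous_on UNIV pr" unfolding pr_def
    using a0 by (intro continuous_intros) auto
  then have "open (pr -` O')"
    using assms(2) open_vimage by blast
  moreover have "p0 \<in> pr -` O'" using p0 by (simp add: pr_def)
  \<comment> \<open>A normal with zero projection would be a multiple of \<open>a\<close> and give
    the same hyperplane.\<close>
  moreover have "0 \<notin> pr ` A"
  proof
    assume "0 \<in> pr ` A"
    then obtain b where b: "b \<in> A" "b = ((a \<bullet> b) / (a \<bullet> a)) *\<^sub>R a" by (auto simp: pr_def)
    moreover have "b \<noteq> 0" using b insert by auto
    ultimately have "{L. a \<bullet> L = 0} = {L. b \<bullet> L = 0}" using hyperplane_in_multiple by blast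
    then show False using insert.prems(2) insert.hyps(2) b(1) by (auto simp: inj_on_def)
  qed
  ultimately obtain x where "x \<in> pr -` O'" "\<forall>b\<in>pr ` A. b \<bullet> x \<noteq> 0"
    using exists_generic_point[of "pr -` O'" "pr ` A"] insert.hyps(1) by auto
  then obtain l where l: "l \<in> O'" "a \<bullet> l = 0" "\<And>b. b \<in> A \<Longrightarrow> b \<bullet> l \<noteq> 0"
    using apr bpr by (metis image_eqI vimageE)
  \<comment> \<open>\<open>U\<close> is the part of \<open>O'\<close> on the same side as
    \<open>l\<close> of every old hyperplane; the hyperplane of \<open>a\<close> cuts it at
    \<open>l\<close>.\<close>
  define U where "U = O' \<inter> (\<Inter>b\<in>A. {q. 0 < (b \<bullet> q) * (b \<bullet> l)})"
  have U: "open U" unfolding U_def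
    using insert.hyps(1) assms(2)
    by (intro open_Int open_INT) (auto intro!: open_Collect_less continuous_intros)
  have "l \<in> U" unfolding U_def using l
    by (auto simp: zero_less_mult_iff) (metis linorder_neqE_linordered_idom)
  obtain e where e: "e > 0" "cball l e \<subseteq> U"
    using U \<open>l \<in> U\<close> open_contains_cball by blast
  have side: "\<exists>q\<in>U. 0 < s * (a \<bullet> q) \<and> (\<forall>b\<in>B. b \<bullet> q \<noteq> 0)" if s: "s = 1 \<or> s = -1" for s :: real
  proof -
    let ?q = "l + (s * e / norm a) *\<^sub>R a"
    have "?q \<in> cball l e"
      using e a0 s by (auto simp: dist_norm)
    moreover have "0 < s * (a \<bullet> ?q)"
      using s l(2) a0 e by (auto simp: inner_add_right)
    ultimately have "?q \<in> U \<inter> {q. 0 < s * (a \<bullet> q)}" using e by auto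
    moreover have "open (U \<inter> {q. 0 < s * (a \<bullet> q)})"
      using U by (intro open_Int open_Collect_less continuous_intros)
    ultimately show ?thesis
      using exists_generic_point[of "U \<inter> {q. 0 < s * (a \<bullet> q)}" B] assms(4,5) by blast
  qed
  obtain q where q: "q \<in> U" "a \<bullet> q > 0" "\<forall>b\<in>B. b \<bullet> q \<noteq> 0"
    using side[of 1] by auto
  obtain r where r: "r \<in> U" "a \<bullet> r < 0" "\<forall>b\<in>B. b \<bullet> r \<noteq> 0"
    using side[of "-1"] by auto
  have transfer: "(b \<bullet> p) * (b \<bullet> q') < 0"
    if "(b \<bullet> p) * (b \<bullet> l) < 0" "b \<in> A" "q' \<in> U" for b p q'
    using that unfolding U_def by (auto simp: mult_less_0_iff zero_less_mult_iff)
  show ?case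
  \<comment> \<open>At most one old point \<open>p\<close> is not separated from \<open>l\<close>.
    If it exists, \<open>q\<close> and \<open>r\<close> replace it; otherwise \<open>q\<close> alone
    is added.\<close>
  proof (cases "\<exists>p\<in>P. \<forall>b\<in>A. \<not> (b \<bullet> p) * (b \<bullet> l) < 0")
    case True
    then obtain p where p: "p \<in> P" "\<forall>b\<in>A. \<not> (b \<bullet> p) * (b \<bullet> l) < 0" by auto
    have sep: "\<exists>b\<in>A. (b \<bullet> p') * (b \<bullet> l) < 0" if p': "p' \<in> P - {p}" for p'
    proof -
      obtain b where "b \<in> A" "(b \<bullet> p) * (b \<bullet> p') < 0" using P(5)[of p p'] p p' by blast
      moreover from this have "\<not> (b \<bullet> p) * (b \<bullet> l) < 0" "b \<bullet> l \<noteq> 0" using p l(3) by auto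
      ultimately show ?thesis by (auto simp: mult_less_0_iff not_less zero_le_mult_iff)
    qed
    have sep': "\<exists>b\<in>A. (b \<bullet> p') * (b \<bullet> q') < 0" if "p' \<in> P - {p}" "q' \<in> U" for p' q'
      using sep[OF that(1)] transfer that(2) by blast
    have nq: "q' \<notin> P - {p}" if "q' \<in> U" for q'
      using sep'[of q' q'] that by (auto simp: mult_less_0_iff)
    let ?P = "insert q (insert r (P - {p}))"
    have "q \<noteq> r" using q r by auto
    then have "card ?P = card P + 1"
      using nq q(1) r(1) p(1) P(1) by (simp add: card_gt_0_iff) (metis Suc_pred card_gt_0_iff empty_iff)
    moreover have "?P \<subseteq> O'" using P(2) q(1) r(1) unfolding U_def by auto
    moreover have "\<exists>c\<in>insert a A. (c \<bullet> x) * (c \<bullet> y) < 0" if "x \<in> ?P" "y \<in> ?P" "x \<noteq> y" for x y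
    proof -
      have qr: "(a \<bullet> q) * (a \<bullet> r) < 0" "(a \<bullet> r) * (a \<bullet> q) < 0"
        using q r by (auto simp: mult_less_0_iff)
      from that consider "x \<in> P - {p}" "y \<in> P - {p}" | "x \<in> P - {p}" "y \<in> U"
        | "y \<in> P - {p}" "x \<in> U" | "x = q" "y = r" | "x = r" "y = q"
        using q(1) r(1) by blast
      then show ?thesis
      proof cases
        case 1 then show ?thesis using P(5) that(3) by blast
      next
        case 2 then show ?thesis using sep' by blast
      next
        case 3 then show ?thesis using sep'[of y x] by (auto simp: mult.commute)
      qed (use qr in auto)
    qed
    ultimately show ?thesis
      using P q r insert.hyps by (intro exI[of _ ?P]) auto
  next
    case False
    then have sep: "\<exists>b\<in>A. (b \<bullet> p') * (b \<bullet> q) < 0" if "p' \<in> P" for p'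
      using that transfer q(1) by blast
    have "q \<notin> P" using sep[of q] by (auto simp: mult_less_0_iff)
    moreover have "\<exists>c\<in>insert a A. (c \<bullet> x) * (c \<bullet> y) < 0"
      if "x \<in> insert q P" "y \<in> insert q P" "x \<noteq> y" for x y
    proof -
      from that consider "x \<in> P" "y \<in> P" | "x \<in> P" "y = q" | "y \<in> P" "x = q" by blast
      then show ?thesis
      proof cases
        case 1 then show ?thesis using P(5) that(3) by blast
      next
        case 2 then show ?thesis using sep by blast
      next
        case 3 then show ?thesis using sep[of y] by (auto simp: mult.commute)
      qed
    qed
    ultimately show ?thesis
      using P q insert.hyps unfolding U_def by (intro exI[of _ "insert q P"]) auto
  qed
qed

section \<open>Sums of exponentials\<close>

text \<open>Dividing by \<open>exp (t * k)\<close> and differentiating removes the term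
  \<open>k\<close> and multiplies the other coefficients by the nonzero \<open>l - k\<close>, so the
  induction hypothesis applies to them; \<open>t = 0\<close> then yields
  \<open>c k = 0\<close>.\<close>

lemma exp_sum_independent:
  fixes c :: "real \<Rightarrow> real"
  assumes "finite S" "\<delta> > 0" "\<And>t. \<bar>t\<bar> < \<delta> \<Longrightarrow> (\<Sum>l\<in>S. c l * exp (t * l)) = 0" "m \<in> S"
  shows "c m = 0"
  using assms(1,3,4)
proof (induction S arbitrary: c m rule: finite_induct)
  case (insert k S)
  have zero: "(\<Sum>l\<in>S. (c l * (l - k)) * exp (t * l)) = 0" if t: "\<bar>t\<bar> < \<delta>" for t
  proof -
    define g where "g t = c k + (\<Sum>l\<in>S. c l * exp (t * (l - k)))" for t
    have g0: "g t = 0" if "\<bar>t\<bar> < \<delta>" for t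
    proof -
      have "g t = exp (- t * k) * (\<Sum>l\<in>insert k S. c l * exp (t * l))"
        unfolding g_def using insert.hyps
        by (simp add: algebra_simps sum_distrib_left exp_diff exp_minus field_simps)
      then show ?thesis using insert.prems(1)[OF that] by simp
    qed
    have d: "(g has_real_derivative (\<Sum>l\<in>S. c l * (exp (t * (l - k)) * (l - k)))) (at t)"
      unfolding g_def by (auto intro!: derivative_eq_intros sum.cong)
    have "((\<lambda>_. 0) has_real_derivative (\<Sum>l\<in>S. c l * (exp (t * (l - k)) * (l - k)))) (at t)"
    proof (rule has_field_derivative_transform_within_open[OF d])
      show "open {-\<delta><..<\<delta>}" by simp
    qed (use t g0 in auto)
    then have "(\<Sum>l\<in>S. c l * (exp (t * (l - k)) * (l - k))) = 0"
      using DERIV_const DERIV_unique by blast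
    moreover have "(\<Sum>l\<in>S. (c l * (l - k)) * exp (t * l))
        = exp (t * k) * (\<Sum>l\<in>S. c l * (exp (t * (l - k)) * (l - k)))"
      unfolding sum_distrib_left
      by (intro sum.cong refl) (simp add: right_diff_distrib left_diff_distrib exp_diff)
    ultimately show ?thesis by simp
  qed
  have S0: "c l = 0" if "l \<in> S" for l
  proof -
    have "c l * (l - k) = 0"
      by (rule insert.IH[of "\<lambda>l. c l * (l - k)"]) (use zero that in auto)
    then show ?thesis using that insert.hyps by auto
  qed
  have "c k = 0" using insert.prems(1)[of 0] insert.hyps assms(2) S0 by simp
  then show ?case using S0 insert.prems(2) by auto
qed simp

text \<open>Terms may share an exponent; after merging them the exponents are distinct and
  independence applies.\<close>

lemma exp_sum_groups_zero:
  fixes w l :: "'j \<Rightarrow> real"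
  assumes "finite J" "\<delta> > 0" "\<And>t. \<bar>t\<bar> < \<delta> \<Longrightarrow> (\<Sum>j\<in>J. w j * exp (t * l j)) = 0"
  shows "(\<Sum>j | j \<in> J \<and> l j = m. w j) = 0"
proof (cases "m \<in> l ` J")
  case True
  have "(\<Sum>m\<in>l ` J. (\<Sum>j | j \<in> J \<and> l j = m. w j) * exp (t * m)) = (\<Sum>j\<in>J. w j * exp (t * l j))" for t
    by (subst sum.image_gen[OF assms(1), of _ l])
      (auto simp: sum_distrib_right intro!: sum.cong)
  then show ?thesis
    using exp_sum_independent[of "l ` J" \<delta> "\<lambda>m. \<Sum>j | j \<in> J \<and> l j = m. w j" m] assms True by simp
next
  case False
  then have "{j. j \<in> J \<and> l j = m} = {}" by auto
  then show ?thesis by (simp only: sum.empty)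
qed

text \<open>A substitute for analytic continuation: \<open>t\<close> in the conclusion is arbitrary,
  since all merged coefficients vanish.\<close>

lemma exp_sum_zero_extend:
  fixes w l :: "'j \<Rightarrow> real"
  assumes "finite J" "\<delta> > 0" "\<And>t. \<bar>t\<bar> < \<delta> \<Longrightarrow> (\<Sum>j\<in>J. w j * exp (t * l j)) = 0"
  shows "(\<Sum>j\<in>J. w j * exp (t * l j)) = 0"
proof -
  have "(\<Sum>j\<in>J. w j * exp (t * l j)) = (\<Sum>m\<in>l ` J. (\<Sum>j | j \<in> J \<and> l j = m. w j) * exp (t * m))"
    by (subst sum.image_gen[OF assms(1), of _ l])
      (auto simp: sum_distrib_right intro!: sum.cong)
  then show ?thesis using exp_sum_groups_zero[OF assms] by simp
qed

section \<open>The hyperplane of a morphism of rank n - 1\<close>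

definition weight :: "('x \<Rightarrow> real) \<Rightarrow> 'x list \<Rightarrow> real" where
  "weight L w = sum_list (map L w)"

lemma weight_simps [simp]: "weight L [] = 0" "weight L (x # w) = L x + weight L w"
  by (simp_all add: weight_def)

lemma weight_append [simp]: "weight L (v @ w) = weight L v + weight L w"
  by (simp add: weight_def)

lemma weight_scale [simp]: "weight (\<lambda>x. c * L x) w = c * weight L w"
  by (induction w) (simp_all add: algebra_simps)

lemma weight_eq_sum_count:
  assumes "finite F" "set w \<subseteq> F"
  shows "weight L w = (\<Sum>b\<in>F. real (count_list w b) * L b)"
  using assms(2)
proof (induction w)
  case (Cons y w)
  have "(\<Sum>b\<in>F. real (count_list (y # w) b) * L b)
      = (\<Sum>b\<in>F. (if b = y then L y else 0) + real (count_list w b) * L b)"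
    by (intro sum.cong) (auto simp: algebra_simps)
  also have "\<dots> = L y + weight L w"
    using Cons assms(1) by (simp add: sum.distrib)
  finally show ?case by simp
qed simp

text \<open>Letter weights \<open>d\<close> act as coefficients of the vectors
  \<open>gamma h b\<close>, so this is the real span of the vectors whose rational span defines
  \<open>rank h\<close>.\<close>

definition weight_space :: "('x::finite \<Rightarrow> 'a list) \<Rightarrow> (real ^ 'x) set" where
  "weight_space h = {L. \<exists>d. \<forall>x. L $ x = weight d (h x)}"

definition unit_fun :: "'x \<Rightarrow> 'x \<Rightarrow> rat" where
  "unit_fun x = (\<lambda>i. if i = x then 1 else 0)"

lemma sum_fun_apply: "(\<Sum>x\<in>A. f x) i = (\<Sum>x\<in>A. (f x i :: 'b::comm_monoid_add))"
  by (induction A rule: infinite_finite_induct) auto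

lemma vector_space_rat_scale: "vector_space rat_scale"
  by unfold_locales (auto simp: rat_scale_def plus_fun_def algebra_simps)

lemma finite_dimensional_rat_scale:
  "finite_dimensional_vector_space rat_scale (range (unit_fun :: 'x::finite \<Rightarrow> _))"
proof -
  interpret vector_space "rat_scale :: rat \<Rightarrow> ('x \<Rightarrow> rat) \<Rightarrow> _"
    by (rule vector_space_rat_scale)
  have inj: "inj (unit_fun :: 'x \<Rightarrow> _)"
    by (rule injI) (metis unit_fun_def zero_neq_one)
  have sum_eq: "(\<Sum>x\<in>UNIV. rat_scale (v x) (unit_fun x)) = v" for v :: "'x \<Rightarrow> rat"
    by (rule ext) (simp add: rat_scale_def unit_fun_def sum_fun_apply if_distrib cong: if_cong)
  show ?thesis
  proof
    show "finite (range (unit_fun :: 'x \<Rightarrow> _))" by simp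
    show "independent (range (unit_fun :: 'x \<Rightarrow> _))"
    proof (rule independent_if_scalars_zero)
      fix f and v :: "'x \<Rightarrow> rat"
      assume "(\<Sum>v\<in>range (unit_fun :: 'x \<Rightarrow> _). rat_scale (f v) v) = 0" and v: "v \<in> range unit_fun"
      then have "(\<Sum>x\<in>UNIV. rat_scale (f (unit_fun x)) (unit_fun (x::'x))) = 0"
        by (simp only: sum.reindex[OF inj] o_def)
      then have "(\<lambda>x::'x. f (unit_fun x)) = 0"
        using sum_eq[of "\<lambda>x. f (unit_fun x)"] by simp
      then show "f v = 0" using v by (auto simp: fun_eq_iff)
    qed simp
    show "span (range (unit_fun :: 'x \<Rightarrow> _)) = UNIV"
    proof -
      have "v \<in> span (range unit_fun)" for v :: "'x \<Rightarrow> rat"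
        by (subst sum_eq[symmetric]) (intro span_sum span_scale span_base, auto)
      then show ?thesis by auto
    qed
  qed
qed

text \<open>A rational subspace of codimension one is the kernel of a rational functional, and the
  same functional cuts out its real span. The normalised coordinate \<open>t\<close> is the one to
  be eliminated later.\<close>

lemma weight_space_eq_hyperplane:
  fixes h :: "'x::finite \<Rightarrow> 'a list"
  assumes "rank h = card (UNIV :: 'x set) - 1"
  obtains a :: "real ^ 'x" and t where "a $ t = 1" "weight_space h = {L. a \<bullet> L = 0}"
proof -
  interpret finite_dimensional_vector_space rat_scale "range (unit_fun :: 'x \<Rightarrow> _)"
    by (rule finite_dimensional_rat_scale)
  have inj: "inj (unit_fun :: 'x \<Rightarrow> _)"
    by (rule injI) (metis unit_fun_def zero_neq_one)
  define S where "S = span (range (gamma h))"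
  have sub: "subspace S" unfolding S_def by simp
  have "dim S < dim (UNIV :: ('x \<Rightarrow> rat) set)"
    using assms inj by (simp add: S_def rank_def card_image)
  then have "S \<noteq> UNIV" by auto
  then obtain t where t: "unit_fun t \<notin> S"
  proof -
    assume that: "\<And>t. unit_fun t \<notin> S \<Longrightarrow> thesis"
    have "\<not> range unit_fun \<subseteq> S"
      using \<open>S \<noteq> UNIV\<close> span_minimal[OF _ sub] span_Basis by blast
    then show thesis using that by auto
  qed
  have full: "span (insert (unit_fun t) S) = UNIV"
  proof -
    obtain B where B: "B \<subseteq> S" "independent B" "S \<subseteq> span B" "card B = dim S"
      using basis_exists by blast
    have "unit_fun t \<notin> span B" using t B(1) sub span_minimal by blast
    then have ind: "independent (insert (unit_fun t) B)"
      using B independent_insertI by blast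
    have "unit_fun t \<notin> B" using t B(1) by auto
    then have "card (insert (unit_fun t) B) = Suc (dim S)"
      using B(4) finiteI_independent[OF B(2)] by simp
    then have "card (insert (unit_fun t) B) \<ge> dim (UNIV :: ('x \<Rightarrow> rat) set)"
      using assms inj by (simp add: S_def rank_def card_image)
    then have "UNIV \<subseteq> span (insert (unit_fun t) B)"
      by (intro card_ge_dim_independent ind) simp_all
    then show ?thesis
      using span_mono[of "insert (unit_fun t) B" "insert (unit_fun t) S"] B(1) by blast
  qed
  have "\<exists>k. unit_fun x - rat_scale k (unit_fun t) \<in> S" for x
    using full span_breakdown_eq[of "unit_fun x" "unit_fun t" S] sub
    by (metis UNIV_I span_eq_iff)
  \<comment> \<open>\<open>\<alpha> x\<close> is the coordinate of \<open>unit_fun x\<close> along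
    \<open>unit_fun t\<close> modulo \<open>S\<close>; these are the coefficients of the
    functional.\<close>
  then obtain \<alpha> where \<alpha>: "\<And>x. unit_fun x - rat_scale (\<alpha> x) (unit_fun t) \<in> S" by metis
  \<comment> \<open>Expanding \<open>v\<close> in unit functions leaves \<open>?s\<close> times
    \<open>unit_fun t\<close> in \<open>S\<close>, although \<open>unit_fun t\<close> is not in
    \<open>S\<close>.\<close>
  have \<alpha>0: "(\<Sum>x\<in>UNIV. v x * \<alpha> x) = 0" if v: "v \<in> S" for v
  proof -
    let ?s = "\<Sum>x\<in>UNIV. v x * \<alpha> x"
    have "(\<Sum>x\<in>UNIV. rat_scale (v x) (unit_fun x - rat_scale (\<alpha> x) (unit_fun t))) \<in> S"
      by (intro subspace_sum sub subspace_scale \<alpha>)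
    also have "(\<Sum>x\<in>UNIV. rat_scale (v x) (unit_fun x - rat_scale (\<alpha> x) (unit_fun t)))
        = v - rat_scale ?s (unit_fun t)"
    proof
      fix i
      have "(\<Sum>x\<in>UNIV. rat_scale (v x) (unit_fun x - rat_scale (\<alpha> x) (unit_fun t))) i
          = (\<Sum>x\<in>UNIV. (if i = x then v x else 0) - (if i = t then v x * \<alpha> x else 0))"
        unfolding sum_fun_apply
        by (intro sum.cong) (auto simp: rat_scale_def unit_fun_def algebra_simps)
      also have "\<dots> = v i - (if i = t then ?s else 0)" by (simp add: sum_subtractf)
      also have "\<dots> = (v - rat_scale ?s (unit_fun t)) i"
        by (simp add: rat_scale_def unit_fun_def)
      finally show "(\<Sum>x\<in>UNIV. rat_scale (v x) (unit_fun x - rat_scale (\<alpha> x) (unit_fun t))) i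
          = (v - rat_scale ?s (unit_fun t)) i" .
    qed
    finally have "v - (v - rat_scale ?s (unit_fun t)) \<in> S"
      using v subspace_diff[OF sub] by blast
    then have *: "rat_scale ?s (unit_fun t) \<in> S" by simp
    show ?thesis
    proof (rule ccontr)
      assume "?s \<noteq> 0"
      then have "unit_fun t = rat_scale (1 / ?s) (rat_scale ?s (unit_fun t))" by simp
      then show False using t subspace_scale[OF sub *] by metis
    qed
  qed
  have \<alpha>t: "\<alpha> t = 1"
  proof (rule ccontr)
    assume "\<alpha> t \<noteq> 1"
    have "unit_fun t - rat_scale (\<alpha> t) (unit_fun t) = rat_scale (1 - \<alpha> t) (unit_fun t)"
      by (simp add: scale_left_diff_distrib)
    then have "rat_scale (1 / (1 - \<alpha> t)) (rat_scale (1 - \<alpha> t) (unit_fun t)) \<in> S"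
      using \<alpha>[of t] subspace_scale[OF sub] by metis
    then show False using t \<open>\<alpha> t \<noteq> 1\<close> by simp
  qed
  \<comment> \<open>\<open>W\<close> collects the rational vectors realised by real letter weights.
    It is a subspace containing every \<open>gamma h b\<close>, hence it contains \<open>S\<close>,
    and the vectors that define \<open>\<alpha>\<close> come from letter weights.\<close>
  define W where "W = {v :: 'x \<Rightarrow> rat. \<exists>d. \<forall>x. real_of_rat (v x) = weight d (h x)}"
  have "subspace W"
    unfolding subspace_def
  proof (intro conjI allI ballI)
    show "0 \<in> W" unfolding W_def by (auto intro!: exI[of _ "\<lambda>_. 0"] simp: weight_def)
  next
    fix v w assume "v \<in> W" "w \<in> W"
    then obtain d e where "\<forall>x. real_of_rat (v x) = weight d (h x)" "\<forall>x. real_of_rat (w x) = weight e (h x)"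
      unfolding W_def by auto
    then show "v + w \<in> W" unfolding W_def
      by (auto intro!: exI[of _ "\<lambda>b. d b + e b"] simp: weight_def of_rat_add sum_list_addf)
  next
    fix c v assume "v \<in> W"
    then obtain d where "\<forall>x. real_of_rat (v x) = weight d (h x)"
      unfolding W_def by auto
    then show "rat_scale c v \<in> W" unfolding W_def
      by (auto intro!: exI[of _ "\<lambda>b. real_of_rat c * d b"] simp: rat_scale_def of_rat_mult)
  qed
  moreover have "gamma h b \<in> W" for b
  proof -
    have "real (count_list w b) = weight (\<lambda>b'. if b' = b then 1 else 0) w" for w
      by (induction w) auto
    then show ?thesis unfolding W_def gamma_def by auto
  qed
  ultimately have "S \<subseteq> W" unfolding S_def by (intro span_minimal) auto
  define a :: "real ^ 'x" where "a = (\<chi> x. real_of_rat (\<alpha> x))"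
  have "a \<bullet> L = 0" if "L \<in> weight_space h" for L
  proof -
    obtain d where d: "\<And>x. L $ x = weight d (h x)" using \<open>L \<in> weight_space h\<close> unfolding weight_space_def by auto
    define F where "F = (\<Union>x. set (h x))"
    have F: "finite F" "\<And>x. set (h x) \<subseteq> F" unfolding F_def by auto
    have g: "(\<Sum>x\<in>UNIV. real (count_list (h x) b) * a $ x) = 0" for b
    proof -
      have "gamma h b \<in> S" unfolding S_def by (intro span_base) auto
      from \<alpha>0[OF this] have "real_of_rat (\<Sum>x\<in>UNIV. gamma h b x * \<alpha> x) = 0" by simp
      then show ?thesis by (simp add: of_rat_sum of_rat_mult gamma_def a_def)
    qed
    have "a \<bullet> L = (\<Sum>x\<in>UNIV. \<Sum>b\<in>F. a $ x * (real (count_list (h x) b) * d b))"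
      unfolding inner_vec_def inner_real_def d
      by (intro sum.cong refl, subst weight_eq_sum_count[OF F]) (simp add: sum_distrib_left)
    also have "\<dots> = (\<Sum>b\<in>F. d b * (\<Sum>x\<in>UNIV. real (count_list (h x) b) * a $ x))"
      by (subst sum.swap) (simp add: sum_distrib_left mult_ac)
    finally show ?thesis using g by simp
  qed
  moreover have "L \<in> weight_space h" if L: "a \<bullet> L = 0" for L
  proof -
    have "\<forall>s. \<exists>d. \<forall>x. real_of_rat ((unit_fun s - rat_scale (\<alpha> s) (unit_fun t)) x) = weight d (h x)"
      using \<alpha> \<open>S \<subseteq> W\<close> unfolding W_def by blast
    then obtain d where
      d: "\<And>s x. real_of_rat ((unit_fun s - rat_scale (\<alpha> s) (unit_fun t)) x) = weight (d s) (h x)"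
      by metis
    have w: "weight (\<lambda>b. \<Sum>s\<in>UNIV. L $ s * d s b) w = (\<Sum>s\<in>UNIV. L $ s * weight (d s) w)" for w
      by (induction w) (simp_all add: algebra_simps sum.distrib)
    \<comment> \<open>On the kernel of \<open>a\<close>, \<open>L\<close> is the combination of the
      vectors \<open>unit_fun s - rat_scale (\<alpha> s) (unit_fun t)\<close> with coefficients
      \<open>L $ s\<close>.\<close>
    have "L $ x = weight (\<lambda>b. \<Sum>s\<in>UNIV. L $ s * d s b) (h x)" for x
    proof -
      have "(\<Sum>s\<in>UNIV. L $ s * weight (d s) (h x))
          = (\<Sum>s\<in>UNIV. (if s = x then L $ s else 0) - (if x = t then L $ s * a $ s else 0))"
        unfolding d[symmetric]
        by (intro sum.cong refl)
          (auto simp: unit_fun_def rat_scale_def a_def of_rat_diff algebra_simps)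
      also have "\<dots> = L $ x - (if x = t then a \<bullet> L else 0)"
        by (auto simp: sum_subtractf inner_vec_def mult_ac)
      finally show ?thesis using L w by simp
    qed
    then show ?thesis unfolding weight_space_def by blast
  qed
  ultimately have "weight_space h = {L. a \<bullet> L = 0}" by auto
  moreover have "a $ t = 1" by (simp add: a_def \<alpha>t)
  ultimately show ?thesis using that by blast
qed

section \<open>Hyperplanes on which an exponential sum vanishes\<close>

lemma weight_eq_inner:
  "weight (($) L) w = (\<chi> x. real (count_list w x)) \<bullet> (L :: real ^ 'x::finite)"
  by (subst weight_eq_sum_count[of UNIV]) (auto simp: inner_vec_def)

text \<open>\<open>\<kappa>\<close> names the chain of a term. Each of the \<open>card A + 1\<close>
  regions in the positive orthant receives the exponent minimal there, and different regions get
  different chains.\<close>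

lemma card_hyperplanes_less_chains:
  fixes A :: "(real ^ 'x::finite) set" and e :: "'j \<Rightarrow> 'x list" and w :: "'j \<Rightarrow> real"
    and \<kappa> :: "'j \<Rightarrow> 'k" and J :: "'j set"
  defines "F \<equiv> \<lambda>L. \<Sum>j\<in>J. w j * exp (weight (($) L) (e j))"
  assumes "finite J" "finite A" "inj_on (\<lambda>a. {L. a \<bullet> L = 0}) A"
    and A: "\<And>a. a \<in> A \<Longrightarrow> a \<noteq> 0 \<and> (\<exists>p. (\<forall>x. 0 < p $ x) \<and> a \<bullet> p = 0)"
    and F0: "\<And>a L. a \<in> A \<Longrightarrow> a \<bullet> L = 0 \<Longrightarrow> F L = 0"
    and "F L0 \<noteq> 0"
    and chain: "\<And>i j. i \<in> J \<Longrightarrow> j \<in> J \<Longrightarrow> \<kappa> i = \<kappa> j \<Longrightarrow>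
        (\<forall>x. count_list (e i) x \<le> count_list (e j) x) \<or> (\<forall>x. count_list (e j) x \<le> count_list (e i) x)"
  shows "card A + 1 \<le> card (\<kappa> ` J)"
proof -
  define v :: "'j \<Rightarrow> real ^ 'x" where "v j = (\<chi> x. real (count_list (e j) x))" for j
  define c where "c f = (\<Sum>j | j \<in> J \<and> v j = f. w j)" for f
  have F: "F L = (\<Sum>f\<in>v ` J. c f * exp (f \<bullet> L))" for L
    unfolding F_def weight_eq_inner v_def[symmetric]
    by (subst sum.image_gen[OF assms(2), of _ v])
      (auto simp: sum_distrib_right c_def intro!: sum.cong)
  \<comment> \<open>Equal exponents can cancel, so minimizers are sought only among those with
    nonzero total coefficient.\<close>
  define S where "S = {f \<in> v ` J. c f \<noteq> 0}"
  have S: "finite S" using assms(2) by (simp add: S_def)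
  have "S \<noteq> {}"
  proof
    assume "S = {}"
    then have "F L0 = 0" unfolding F S_def by (intro sum.neutral) auto
    then show False using assms(7) by simp
  qed
  \<comment> \<open>A point orthogonal to no difference of two exponents has a unique
    minimizer.\<close>
  define B where "B = (\<lambda>(f, g). f - g) ` {(f, g) \<in> S \<times> S. f \<noteq> g}"
  have "finite {(f, g) \<in> S \<times> S. f \<noteq> g}"
    by (rule finite_subset[of _ "S \<times> S"]) (use S in auto)
  then have "finite B" unfolding B_def by (rule finite_imageI)
  moreover have "0 \<notin> B" by (auto simp: B_def)
  moreover have "open {p :: real ^ 'x. \<forall>x. 0 < p $ x}"
    unfolding Collect_all_eq
    by (intro open_INT ballI open_Collect_less continuous_intros) simp
  moreover have "(\<chi> x. 1) \<in> {p :: real ^ 'x. \<forall>x. 0 < p $ x}" by simp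
  moreover have "\<exists>p\<in>{p. \<forall>x. 0 < p $ x}. a \<bullet> p = 0" if "a \<in> A" for a
    using A[OF that] by auto
  ultimately have "\<exists>P. finite P \<and> P \<subseteq> {p :: real ^ 'x. \<forall>x. 0 < p $ x} \<and> card P = card A + 1
     \<and> (\<forall>p\<in>P. \<forall>b\<in>B. b \<bullet> p \<noteq> 0)
     \<and> (\<forall>p\<in>P. \<forall>q\<in>P. p \<noteq> q \<longrightarrow> (\<exists>a\<in>A. (a \<bullet> p) * (a \<bullet> q) < 0))"
    using A assms(3,4) by (intro exists_separated_points) blast+
  then obtain P where P: "finite P" "P \<subseteq> {p :: real ^ 'x. \<forall>x. 0 < p $ x}"
      "card P = card A + 1" "\<forall>p\<in>P. \<forall>b\<in>B. b \<bullet> p \<noteq> 0"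
      "\<forall>p\<in>P. \<forall>q\<in>P. p \<noteq> q \<longrightarrow> (\<exists>a\<in>A. (a \<bullet> p) * (a \<bullet> q) < 0)"
    by (elim exE conjE) (rule that; assumption)
  have "\<exists>f\<in>S. \<forall>g\<in>S. f \<bullet> p \<le> g \<bullet> p" for p
    using arg_min_if_finite[OF S \<open>S \<noteq> {}\<close>, of "\<lambda>f. f \<bullet> p"] by (metis not_le)
  then obtain m where m: "\<And>p. m p \<in> S" "\<And>p g. g \<in> S \<Longrightarrow> m p \<bullet> p \<le> g \<bullet> p" by metis
  have strict: "m p \<bullet> p < g \<bullet> p" if "p \<in> P" "g \<in> S" "g \<noteq> m p" for p g
  proof -
    have "g - m p \<in> B" unfolding B_def using that m(1)[of p] by force
    then have "(g - m p) \<bullet> p \<noteq> 0" using P(4) that by blast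
    then show ?thesis using m(2)[OF that(2), of p] by (auto simp: inner_diff_left)
  qed
  have m_inj: "m p \<noteq> m q" if pq: "p \<in> P" "q \<in> P" "p \<noteq> q" for p q
  proof
    assume eq: "m p = m q"
    obtain a where a: "a \<in> A" "(a \<bullet> p) * (a \<bullet> q) < 0" using P(5) pq by blast
    \<comment> \<open>\<open>L\<close> is a positive multiple of the point where the segment from
      \<open>p\<close> to \<open>q\<close> crosses the hyperplane of \<open>a\<close>. A strict
      minimizer common to \<open>p\<close> and \<open>q\<close> is strict at \<open>L\<close> as
      well.\<close>
    define L where "L = \<bar>a \<bullet> q\<bar> *\<^sub>R p + \<bar>a \<bullet> p\<bar> *\<^sub>R q"
    have aL: "a \<bullet> L = 0" using a(2) by (auto simp: L_def inner_add_right mult_less_0_iff)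
    have less: "m p \<bullet> L < g \<bullet> L" if g: "g \<in> S" "g \<noteq> m p" for g
    proof -
      have "\<bar>a \<bullet> q\<bar> * (m p \<bullet> p) < \<bar>a \<bullet> q\<bar> * (g \<bullet> p)"
        using strict[OF pq(1) g] a(2) by (intro mult_strict_left_mono) auto
      moreover have "\<bar>a \<bullet> p\<bar> * (m p \<bullet> q) < \<bar>a \<bullet> p\<bar> * (g \<bullet> q)"
        using strict[of q g] pq g eq a(2) by (intro mult_strict_left_mono) auto
      ultimately show ?thesis unfolding L_def by (simp add: inner_add_right)
    qed
    \<comment> \<open>On the line through \<open>L\<close> the exponent \<open>m p\<close> forms a
      group of its own, so vanishing forces its coefficient to be zero.\<close>
    have "(\<Sum>f\<in>v ` J. c f * exp (t * (f \<bullet> L))) = 0" for t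
      using F0[OF a(1), of "t *\<^sub>R L"] aL unfolding F by simp
    then have "(\<Sum>f | f \<in> v ` J \<and> f \<bullet> L = m p \<bullet> L. c f) = 0"
      using exp_sum_groups_zero[of "v ` J" 1 c "\<lambda>f. f \<bullet> L"] assms(2) by simp
    moreover have "c g = 0" if "g \<in> v ` J" "g \<bullet> L = m p \<bullet> L" "g \<noteq> m p" for g
    proof (rule ccontr)
      assume "c g \<noteq> 0"
      then show False using less[of g] that by (simp add: S_def)
    qed
    then have "(\<Sum>f | f \<in> v ` J \<and> f \<bullet> L = m p \<bullet> L. c f) = (\<Sum>f\<in>{m p}. c f)"
      using assms(2) m(1)[of p] by (intro sum.mono_neutral_right) (auto simp: S_def)
    ultimately show False using m(1)[of p] by (simp add: S_def)
  qed
  have "\<exists>j\<in>J. v j = f" if "f \<in> S" for f using that by (auto simp: S_def)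
  then obtain j where j: "\<And>f. f \<in> S \<Longrightarrow> j f \<in> J \<and> v (j f) = f" by metis
  \<comment> \<open>At \<open>q\<close>, whose coordinates are positive, a different exponent
    componentwise below \<open>m q\<close> would beat the minimizer.\<close>
  have no_le: "\<not> (\<forall>x. count_list (e (j (m p))) x \<le> count_list (e (j (m q))) x)"
    if pq: "p \<in> P" "q \<in> P" "p \<noteq> q" for p q
  proof
    assume "\<forall>x. count_list (e (j (m p))) x \<le> count_list (e (j (m q))) x"
    then have "v (j (m p)) $ x \<le> v (j (m q)) $ x" for x by (simp add: v_def)
    then have le: "m p $ x \<le> m q $ x" for x using j m(1) by simp
    obtain x where "m p $ x \<noteq> m q $ x" using m_inj[OF pq] by (auto simp: vec_eq_iff)
    then have x: "m p $ x < m q $ x" using le[of x] by simp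
    have "m p \<bullet> q < m q \<bullet> q"
      unfolding inner_vec_def inner_real_def
    proof (rule sum_strict_mono_ex1)
      have q: "0 < q $ y" for y using P(2) pq(2) by auto
      show "\<forall>y\<in>UNIV. m p $ y * q $ y \<le> m q $ y * q $ y"
        using le q by (intro ballI mult_right_mono) (auto simp: less_imp_le)
      show "\<exists>y\<in>UNIV. m p $ y * q $ y < m q $ y * q $ y"
        using x q by (intro bexI[of _ x] mult_strict_right_mono) auto
    qed simp
    then show False using m(2)[OF m(1), of q p] by simp
  qed
  have "inj_on (\<lambda>p. \<kappa> (j (m p))) P"
  proof (rule inj_onI, rule ccontr)
    fix p q assume "p \<in> P" "q \<in> P" "\<kappa> (j (m p)) = \<kappa> (j (m q))" "p \<noteq> q"
    then show False using no_le[of p q] no_le[of q p] chain j m(1) by metis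
  qed
  moreover have "(\<lambda>p. \<kappa> (j (m p))) ` P \<subseteq> \<kappa> ` J" using j m(1) by auto
  ultimately have "card P \<le> card (\<kappa> ` J)" using assms(2) by (metis card_inj_on_le finite_imageI)
  then show ?thesis using P(3) by simp
qed

section \<open>Word equations as linear equations\<close>

text \<open>These are Saarela's polynomials of a word and of an equation, with the variable \<open>X\<close> replaced by
\<open>exp\<close> of a real weight so that non-integral length types are allowed.\<close>

primrec occ_sum :: "'x list \<Rightarrow> 'x \<Rightarrow> ('x \<Rightarrow> real) \<Rightarrow> real" where
  "occ_sum [] x L = 0"
| "occ_sum (y # w) x L = (if y = x then 1 else 0) + exp (L y) * occ_sum w x L"

primrec word_sum :: "('b \<Rightarrow> real) \<Rightarrow> ('b \<Rightarrow> real) \<Rightarrow> 'b list \<Rightarrow> real" where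
  "word_sum d c [] = 0"
| "word_sum d c (b # w) = d b + exp (c b) * word_sum d c w"

definition occ_diff :: "'x eqn \<Rightarrow> 'x \<Rightarrow> ('x \<Rightarrow> real) \<Rightarrow> real" where
  "occ_diff E x L = occ_sum (fst E) x L - occ_sum (snd E) x L"

lemma word_sum_append: "word_sum d c (v @ w) = word_sum d c v + exp (weight c v) * word_sum d c w"
  by (induction v) (simp_all add: algebra_simps exp_add)

text \<open>The block \<open>h x\<close> of an occurrence of \<open>x\<close> contributes its own
  word sum times \<open>exp\<close> of the weight of the blocks before it; these factors are
  collected per unknown.\<close>

lemma word_sum_morph:
  fixes h :: "'x::finite \<Rightarrow> 'b list"
  shows "word_sum d c (morph h u) = (\<Sum>x\<in>UNIV. occ_sum u x (\<lambda>x. weight c (h x)) * word_sum d c (h x))"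
proof (induction u)
  case (Cons y u)
  have "(\<Sum>x\<in>UNIV. occ_sum (y # u) x (\<lambda>x. weight c (h x)) * word_sum d c (h x))
      = (\<Sum>x\<in>UNIV. (if y = x then word_sum d c (h x) else 0)
          + exp (weight c (h y)) * (occ_sum u x (\<lambda>x. weight c (h x)) * word_sum d c (h x)))"
    by (intro sum.cong) (auto simp: algebra_simps)
  also have "\<dots> = word_sum d c (h y) + exp (weight c (h y)) * word_sum d c (morph h u)"
    by (simp add: sum.distrib sum_distrib_left[symmetric] Cons)
  also have "\<dots> = word_sum d c (morph h (y # u))" by (simp add: morph_def word_sum_append)
  finally show ?case by simp
qed (simp add: morph_def)

text \<open>For a solution the right-hand side is zero: the vector of \<open>occ_diff\<close> values
  is orthogonal to the word sum vector of every \<open>d\<close>.\<close>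

lemma sum_occ_diff_word_sum:
  fixes h :: "'x::finite \<Rightarrow> 'b list"
  shows "(\<Sum>x\<in>UNIV. occ_diff E x (\<lambda>x. weight c (h x)) * word_sum d c (h x))
      = word_sum d c (morph h (fst E)) - word_sum d c (morph h (snd E))"
  by (simp add: occ_diff_def word_sum_morph left_diff_distrib sum_subtractf)

lemma word_sum_zero: "word_sum d (\<lambda>b. 0) w = weight d w"
  by (induction w) simp_all

lemma continuous_word_sum: "continuous_on UNIV (\<lambda>t::real. word_sum d (\<lambda>b. t * c b) w)"
  by (induction w) (auto intro!: continuous_intros)

lemma axis_diff_in_weight_space:
  fixes h :: "'x::finite \<Rightarrow> 'b list"
  assumes "a $ t0 = 1" "weight_space h = {L. a \<bullet> L = 0}"
  shows "(\<chi> x. (if x = s then 1 else 0) - (if x = t0 then a $ s else 0)) \<in> weight_space h"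
proof -
  let ?v = "\<chi> x. (if x = s then 1 else 0) - (if x = t0 then a $ s else 0)"
  have "a \<bullet> ?v = (\<Sum>x\<in>UNIV. (if x = s then a $ x else 0) - (if x = t0 then a $ s * a $ x else 0))"
    unfolding inner_vec_def by (intro sum.cong) (auto simp: algebra_simps)
  then show ?thesis unfolding assms(2) using assms(1) by (simp add: sum_subtractf)
qed

text \<open>Near \<open>t = 0\<close> the matrix of the \<open>word_sum\<close>-values of a morphism of rank \<open>n - 1\<close>, with column \<open>t0\<close>
removed, is close to the identity matrix and hence invertible.\<close>

lemma orthogonal_word_sum_eq_0:
  fixes h :: "'x::finite \<Rightarrow> 'b list"
  assumes "a $ t0 = 1" "weight_space h = {L. a \<bullet> L = 0}"
  obtains \<delta> :: real where "\<delta> > 0"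
    "\<And>t R y. \<lbrakk>\<bar>t\<bar> < \<delta>; R t0 = 0;
        \<And>d. (\<Sum>x\<in>UNIV. R x * word_sum d (\<lambda>b. t * c b) (h x)) = 0\<rbrakk> \<Longrightarrow> R y = (0::real)"
proof -
  define n where "n = real CARD('x)"
  have n: "n > 0" by (simp add: n_def)
  have "\<forall>s. \<exists>d. \<forall>x. weight d (h x) = (if x = s then 1 else 0) - (if x = t0 then a $ s else 0)"
    using axis_diff_in_weight_space[OF assms] unfolding weight_space_def by (simp add: eq_commute)
  then obtain d where d: "\<And>s x. weight (d s) (h x) = (if x = s then 1 else 0) - (if x = t0 then a $ s else 0)"
    by metis
  have "\<forall>\<^sub>F t in nhds 0. \<bar>word_sum (d s) (\<lambda>b. t * c b) (h x) - weight (d s) (h x)\<bar> < 1 / n" for s x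
  proof -
    have "isCont (\<lambda>t. word_sum (d s) (\<lambda>b. t * c b) (h x)) 0"
      using continuous_word_sum[of "d s" c "h x"] by (simp add: continuous_on_eq_continuous_at)
    then have "((\<lambda>t. word_sum (d s) (\<lambda>b. t * c b) (h x)) \<longlongrightarrow> weight (d s) (h x)) (at 0)"
      by (simp add: isCont_def word_sum_zero)
    then have "\<forall>\<^sub>F t in at 0. dist (word_sum (d s) (\<lambda>b. t * c b) (h x)) (weight (d s) (h x)) < 1 / n"
      using n by (intro tendstoD) auto
    then show ?thesis using n
      by (simp add: eventually_nhds_conv_at word_sum_zero dist_real_def)
  qed
  then have "\<forall>\<^sub>F t in nhds 0. \<forall>s x. \<bar>word_sum (d s) (\<lambda>b. t * c b) (h x) - weight (d s) (h x)\<bar> < 1 / n"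
    by (intro eventually_all_finite) auto
  then obtain \<delta> where \<delta>: "\<delta> > 0"
      "\<And>t s x. \<bar>t\<bar> < \<delta> \<Longrightarrow> \<bar>word_sum (d s) (\<lambda>b. t * c b) (h x) - weight (d s) (h x)\<bar> < 1 / n"
    unfolding eventually_nhds_metric by (auto simp: dist_real_def)
  have "R y = 0"
    if t: "\<bar>t\<bar> < \<delta>" "R t0 = 0" and R: "\<And>d. (\<Sum>x\<in>UNIV. R x * word_sum d (\<lambda>b. t * c b) (h x)) = 0" for t R y
  proof (rule ccontr)
    assume "R y \<noteq> 0"
    \<comment> \<open>At an entry of largest modulus, \<open>R s\<close> is a sum of
      \<open>n\<close> errors, each below \<open>\<bar>R s\<bar> / n\<close>. The column
      \<open>t0\<close>, where the matrix need not be close to the identity, drops out because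
      \<open>R t0 = 0\<close>.\<close>
    obtain s where s: "\<And>x. \<bar>R x\<bar> \<le> \<bar>R s\<bar>"
    proof -
      assume that: "\<And>s. (\<And>x. \<bar>R x\<bar> \<le> \<bar>R s\<bar>) \<Longrightarrow> thesis"
      have "Max (range (\<lambda>x. \<bar>R x\<bar>)) \<in> range (\<lambda>x. \<bar>R x\<bar>)" by (intro Max_in) auto
      then obtain s where "Max (range (\<lambda>x. \<bar>R x\<bar>)) = \<bar>R s\<bar>" by (rule rangeE)
      then have "\<bar>R x\<bar> \<le> \<bar>R s\<bar>" for x by (metis Max_ge finite finite_imageI rangeI)
      then show thesis using that by blast
    qed
    have Rs: "\<bar>R s\<bar> > 0" using s[of y] \<open>R y \<noteq> 0\<close> by simp
    let ?p = "\<lambda>x. word_sum (d s) (\<lambda>b. t * c b) (h x)"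
    have "R s = (\<Sum>x\<in>UNIV. (if x = s then R x else 0)) - (\<Sum>x\<in>UNIV. R x * ?p x)"
      using R[of "d s"] by simp
    also have "\<dots> = (\<Sum>x\<in>UNIV. R x * ((if x = s then 1 else 0) - ?p x))"
      unfolding sum_subtractf[symmetric] by (intro sum.cong) (auto simp: algebra_simps)
    finally have "\<bar>R s\<bar> \<le> (\<Sum>x\<in>UNIV. \<bar>R x * ((if x = s then 1 else 0) - ?p x)\<bar>)"
      by (metis sum_abs)
    also have "\<dots> < (\<Sum>x\<in>(UNIV::'x set). \<bar>R s\<bar> * (1 / n))"
    proof (intro sum_strict_mono)
      fix x :: 'x
      show "\<bar>R x * ((if x = s then 1 else 0) - ?p x)\<bar> < \<bar>R s\<bar> * (1 / n)"
      proof (cases "x = t0")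
        case True
        then show ?thesis using t(2) Rs n by simp
      next
        case False
        then have "\<bar>(if x = s then 1 else 0) - ?p x\<bar> < 1 / n"
          using \<delta>(2)[OF t(1), of s x] by (simp add: d abs_minus_commute)
        then show ?thesis
          unfolding abs_mult using s[of x] Rs
          by (intro le_less_trans[OF mult_right_mono mult_strict_left_mono]) auto
      qed
    qed auto
    also have "\<dots> = \<bar>R s\<bar>" using n by (simp add: n_def)
    finally show False by simp
  qed
  then show ?thesis using that \<delta>(1) by blast
qed

section \<open>Vanishing minors for common solutions\<close>

definition minor :: "'x eqn \<Rightarrow> 'x eqn \<Rightarrow> 'x \<Rightarrow> 'x \<Rightarrow> ('x \<Rightarrow> real) \<Rightarrow> real" where
  "minor E1 E2 k l L = occ_diff E1 k L * occ_diff E2 l L - occ_diff E1 l L * occ_diff E2 k L"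

text \<open>Near \<open>t = 0\<close> both vectors are orthogonal to the same \<open>n - 1\<close>
  independent vectors, hence parallel.\<close>

lemma minor_eq_0_near_0:
  fixes h :: "'x::finite \<Rightarrow> 'b list"
  assumes "rank h = card (UNIV :: 'x set) - 1"
    and "morph h (fst E1) = morph h (snd E1)" "morph h (fst E2) = morph h (snd E2)"
  obtains \<delta> :: real where "\<delta> > 0"
    "\<And>t. \<bar>t\<bar> < \<delta> \<Longrightarrow> minor E1 E2 k l (\<lambda>x. t * weight c (h x)) = 0"
proof -
  obtain a :: "real ^ 'x" and t0 where a: "a $ t0 = 1" "weight_space h = {L. a \<bullet> L = 0}"
    using weight_space_eq_hyperplane[OF assms(1)] .
  obtain \<delta> :: real where \<delta>: "\<delta> > 0"
    "\<And>t R y. \<lbrakk>\<bar>t\<bar> < \<delta>; R t0 = 0;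
        \<And>d. (\<Sum>x\<in>UNIV. R x * word_sum d (\<lambda>b. t * c b) (h x)) = 0\<rbrakk> \<Longrightarrow> R y = (0::real)"
    using orthogonal_word_sum_eq_0[OF a] by metis
  have "minor E1 E2 k l (\<lambda>x. t * weight c (h x)) = 0" if t: "\<bar>t\<bar> < \<delta>" for t
  proof -
    let ?L = "\<lambda>x. t * weight c (h x)"
    have orth: "(\<Sum>x\<in>UNIV. occ_diff E x ?L * word_sum d (\<lambda>b. t * c b) (h x)) = 0"
      if "morph h (fst E) = morph h (snd E)" for E d
      using sum_occ_diff_word_sum[of E "\<lambda>b. t * c b" h d] that by simp
    \<comment> \<open>This combination of the two vectors is chosen to vanish at \<open>t0\<close>,
      so orthogonality makes it vanish everywhere.\<close>
    have R: "occ_diff E1 t0 ?L * occ_diff E2 y ?L - occ_diff E2 t0 ?L * occ_diff E1 y ?L = 0" for y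
    proof (rule \<delta>(2)[OF t, of "\<lambda>y. occ_diff E1 t0 ?L * occ_diff E2 y ?L - occ_diff E2 t0 ?L * occ_diff E1 y ?L"])
      fix d
      show "(\<Sum>x\<in>UNIV. (occ_diff E1 t0 ?L * occ_diff E2 x ?L - occ_diff E2 t0 ?L * occ_diff E1 x ?L)
          * word_sum d (\<lambda>b. t * c b) (h x)) = 0"
        using orth[OF assms(2), of d] orth[OF assms(3), of d]
        by (simp add: left_diff_distrib sum_subtractf mult.assoc sum_distrib_left[symmetric])
    qed simp
    show ?thesis
    proof (cases "occ_diff E1 t0 ?L = 0")
      case True
      then have "occ_diff E1 y ?L = 0" for y
        using \<delta>(2)[OF t, of "\<lambda>y. occ_diff E1 y ?L"] orth[OF assms(2)] by blast
      then show ?thesis by (simp add: minor_def)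
    next
      case False
      have "occ_diff E1 t0 ?L * minor E1 E2 k l ?L
          = occ_diff E1 k ?L * (occ_diff E1 t0 ?L * occ_diff E2 l ?L) - occ_diff E1 l ?L * (occ_diff E1 t0 ?L * occ_diff E2 k ?L)"
        by (simp add: minor_def algebra_simps)
      also have "\<dots> = 0" using R[of l] R[of k] by (simp add: algebra_simps)
      finally show ?thesis using False by simp
    qed
  qed
  then show ?thesis using that \<delta>(1) by blast
qed

section \<open>Occurrences and their prefixes\<close>

primrec occ_prefixes :: "'x list \<Rightarrow> 'x \<Rightarrow> 'x list list" where
  "occ_prefixes [] x = []"
| "occ_prefixes (y # w) x = (if y = x then [[]] else []) @ map ((#) y) (occ_prefixes w x)"

lemma set_occ_prefixes: "p \<in> set (occ_prefixes w x) \<longleftrightarrow> (\<exists>r. w = p @ x # r)"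
proof (induction w arbitrary: p)
  case (Cons y w)
  then show ?case by (cases p) auto
qed simp

lemma distinct_occ_prefixes: "distinct (occ_prefixes w x)"
  by (induction w) (auto simp: distinct_map)

lemma length_occ_prefixes: "length (occ_prefixes w x) = count_list w x"
  by (induction w) auto

lemma occ_sum_eq_sum_list: "occ_sum w x L = (\<Sum>p\<leftarrow>occ_prefixes w x. exp (weight L p))"
  by (induction w) (auto simp: o_def exp_add sum_list_const_mult)

lemma occ_prefixes_filter: "P x \<Longrightarrow> occ_prefixes (filter P w) x = map (filter P) (occ_prefixes w x)"
  by (induction w) (auto simp: o_def)

lemma count_list_filter: "count_list (filter P w) x = (if P x then count_list w x else 0)"
  by (induction w) auto

text \<open>Deleting \<open>x\<close> shows that the prefixes of the i-th occurrence of
  \<open>z\<close> on the two sides agree in all counts except that of \<open>x\<close>; deleting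
  \<open>y\<close> settles that one too.\<close>

lemma occ_sum_eq_if_filters_eq:
  fixes u v :: "'x::finite list"
  assumes "filter (\<lambda>i. i \<noteq> x) u = filter (\<lambda>i. i \<noteq> x) v" "filter (\<lambda>i. i \<noteq> y) u = filter (\<lambda>i. i \<noteq> y) v"
    and "x \<noteq> y" "z \<noteq> x" "z \<noteq> y"
  shows "occ_sum u z L = occ_sum v z L"
proof -
  have m: "map (filter (\<lambda>i. i \<noteq> w)) (occ_prefixes u z) = map (filter (\<lambda>i. i \<noteq> w)) (occ_prefixes v z)"
    if "w = x \<or> w = y" for w
    using that assms occ_prefixes_filter[of "\<lambda>i. i \<noteq> w" z] by metis
  have len: "length (occ_prefixes u z) = length (occ_prefixes v z)" using m[of x] map_eq_imp_length_eq by blast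
  have "weight L (occ_prefixes u z ! i) = weight L (occ_prefixes v z ! i)" if i: "i < length (occ_prefixes u z)" for i
  proof -
    have f: "filter (\<lambda>i. i \<noteq> w) (occ_prefixes u z ! i) = filter (\<lambda>i. i \<noteq> w) (occ_prefixes v z ! i)"
      if "w = x \<or> w = y" for w
      using m[OF that] i len by (metis nth_map)
    have "count_list (occ_prefixes u z ! i) c = count_list (occ_prefixes v z ! i) c" for c
      using f[of x] f[of y] count_list_filter[of "\<lambda>i. i \<noteq> x" _ c]
        count_list_filter[of "\<lambda>i. i \<noteq> y" _ c] assms(3) by metis
    then show ?thesis by (simp add: weight_eq_sum_count[of UNIV])
  qed
  then have "map (\<lambda>p. exp (weight L p)) (occ_prefixes u z) = map (\<lambda>p. exp (weight L p)) (occ_prefixes v z)"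
    using len by (intro nth_equalityI) auto
  then show ?thesis by (simp add: occ_sum_eq_sum_list)
qed

section \<open>Minors as exponential sums over pairs of occurrences\<close>

definition side :: "'x eqn \<Rightarrow> bool \<Rightarrow> 'x list" where
  "side E b = (if b then fst E else snd E)"

text \<open>A prefix determines the position after it, so pairs of a side and a prefix represent
  each occurrence exactly once.\<close>

definition occs :: "'x eqn \<Rightarrow> 'x \<Rightarrow> (bool \<times> 'x list) set" where
  "occs E x = (SIGMA b:UNIV. set (occ_prefixes (side E b) x))"

definition side_sign :: "bool \<Rightarrow> real" where
  "side_sign b = (if b then 1 else -1)"

lemma finite_occs [simp]: "finite (occs E x)"
  by (simp add: occs_def)

lemma card_occs: "card (occs E x) = eq_occ E x"
  by (simp add: occs_def eq_occ_def UNIV_bool side_def distinct_card distinct_occ_prefixes length_occ_prefixes)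

lemma occ_diff_eq_sum: "occ_diff E x L = (\<Sum>(b, p)\<in>occs E x. side_sign b * exp (weight L p))"
  unfolding occs_def
  by (subst sum.Sigma[symmetric])
    (auto simp: UNIV_bool occ_diff_def occ_sum_eq_sum_list side_def side_sign_def
      sum_list_distinct_conv_sum_set distinct_occ_prefixes sum_negf)

text \<open>The leading flag tells the two products of the minor apart, keeping the union disjoint,
  and carries their sign.\<close>

definition pairs :: "'x eqn \<Rightarrow> 'x eqn \<Rightarrow> 'x \<Rightarrow> 'x \<Rightarrow> (bool \<times> (bool \<times> 'x list) \<times> (bool \<times> 'x list)) set" where
  "pairs E1 E2 k l = {True} \<times> occs E1 k \<times> occs E2 l \<union> {False} \<times> occs E1 l \<times> occs E2 k"

fun pair_side_sign :: "bool \<times> (bool \<times> 'x list) \<times> (bool \<times> 'x list) \<Rightarrow> real" where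
  "pair_side_sign (s, (b, p), (c, q)) = side_sign s * side_sign b * side_sign c"

fun pair_word :: "bool \<times> (bool \<times> 'x list) \<times> (bool \<times> 'x list) \<Rightarrow> 'x list" where
  "pair_word (s, (b, p), (c, q)) = p @ q"

lemma finite_pairs [simp]: "finite (pairs E1 E2 k l)"
  by (simp add: pairs_def)

lemma minor_eq_sum: "minor E1 E2 k l L = (\<Sum>j\<in>pairs E1 E2 k l. pair_side_sign j * exp (weight L (pair_word j)))"
proof -
  have prod: "(\<Sum>j\<in>{s} \<times> P \<times> Q. pair_side_sign j * exp (weight L (pair_word j)))
      = side_sign s * ((\<Sum>(b, p)\<in>P. side_sign b * exp (weight L p)) * (\<Sum>(c, q)\<in>Q. side_sign c * exp (weight L q)))" for s P Q
  proof -
    have "{s} \<times> P \<times> Q = Pair s ` (P \<times> Q)" by auto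
    then have "(\<Sum>j\<in>{s} \<times> P \<times> Q. pair_side_sign j * exp (weight L (pair_word j)))
        = (\<Sum>j\<in>P \<times> Q. pair_side_sign (s, j) * exp (weight L (pair_word (s, j))))"
      by (simp add: sum.reindex inj_on_def)
    also have "\<dots> = (\<Sum>(y, z)\<in>P \<times> Q. side_sign s * ((case y of (b, p) \<Rightarrow> side_sign b * exp (weight L p))
        * (case z of (c, q) \<Rightarrow> side_sign c * exp (weight L q))))"
      by (intro sum.cong) (auto simp: exp_add)
    also have "\<dots> = side_sign s * ((\<Sum>(b, p)\<in>P. side_sign b * exp (weight L p)) * (\<Sum>(c, q)\<in>Q. side_sign c * exp (weight L q)))"
      unfolding sum_product sum.cartesian_product
      by (simp only: sum_distrib_left case_prod_unfold)
    finally show ?thesis .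
  qed
  have "(\<Sum>j\<in>pairs E1 E2 k l. pair_side_sign j * exp (weight L (pair_word j)))
      = (\<Sum>j\<in>{True} \<times> occs E1 k \<times> occs E2 l. pair_side_sign j * exp (weight L (pair_word j)))
      + (\<Sum>j\<in>{False} \<times> occs E1 l \<times> occs E2 k. pair_side_sign j * exp (weight L (pair_word j)))"
    unfolding pairs_def by (intro sum.union_disjoint) auto
  then show ?thesis unfolding prod by (simp add: side_sign_def minor_def occ_diff_eq_sum)
qed

text \<open>Scaling the weights by \<open>t\<close> makes the minor an exponential sum in
  \<open>t\<close>; vanishing near 0 extends to \<open>t = 1\<close>.\<close>

lemma minor_eq_0_on_weight_space:
  fixes h :: "'x::finite \<Rightarrow> 'b list"
  assumes "rank h = card (UNIV :: 'x set) - 1"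
    and "morph h (fst E1) = morph h (snd E1)" "morph h (fst E2) = morph h (snd E2)"
    and "L \<in> weight_space h"
  shows "minor E1 E2 k l (($) L) = 0"
proof -
  obtain c where c: "\<And>x. L $ x = weight c (h x)" using assms(4) unfolding weight_space_def by auto
  obtain \<delta> where \<delta>: "\<delta> > 0" "\<And>t. \<bar>t\<bar> < \<delta> \<Longrightarrow> minor E1 E2 k l (\<lambda>x. t * weight c (h x)) = 0"
    using minor_eq_0_near_0[OF assms(1-3)] by blast
  have "(\<Sum>j\<in>pairs E1 E2 k l. pair_side_sign j * exp (1 * weight (($) L) (pair_word j))) = 0"
  proof (rule exp_sum_zero_extend[OF finite_pairs \<delta>(1)])
    fix t assume "\<bar>t\<bar> < \<delta>"
    then have "minor E1 E2 k l (\<lambda>x. t * L $ x) = 0" using \<delta>(2) c by simp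
    then show "(\<Sum>j\<in>pairs E1 E2 k l. pair_side_sign j * exp (t * weight (($) L) (pair_word j))) = 0"
      by (simp add: minor_eq_sum)
  qed
  then show ?thesis by (simp add: minor_eq_sum)
qed

section \<open>Nontrivial equations and transfer of solutions\<close>

lemma occ_sum_nonneg: "0 \<le> occ_sum w x L"
  by (induction w) auto

lemma occ_sum_le_length:
  assumes "\<And>x. L x \<le> 0"
  shows "occ_sum w x L \<le> length w"
proof (induction w)
  case (Cons y w)
  have "exp (L y) * occ_sum w x L \<le> 1 * real (length w)"
    using Cons assms occ_sum_nonneg by (intro mult_mono) auto
  then show ?case by auto
qed simp

lemma exp_small:
  fixes l N :: real
  assumes "l > 0"
  obtains t0 where "t0 \<le> 0" "\<And>t. t \<le> t0 \<Longrightarrow> exp (t * l) * N < 1"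
proof
  \<comment> \<open>Since \<open>M < exp M\<close>, the factor \<open>exp (- M)\<close> suffices;
    the maximum with 0 covers negative \<open>N\<close>.\<close>
  define M where "M = max N 0"
  show "- M / l \<le> 0" using assms by (simp add: M_def)
  fix t assume "t \<le> - M / l"
  then have "t * l \<le> - M" using assms by (metis pos_le_divide_eq)
  have "exp (t * l) * N \<le> exp (t * l) * M" by (intro mult_left_mono) (auto simp: M_def)
  also have "\<dots> \<le> exp (- M) * M"
    using \<open>t * l \<le> - M\<close> by (intro mult_right_mono) (auto simp: M_def)
  also have "M < exp M" using exp_ge_add_one_self[of M] by linarith
  then have "exp (- M) * M < exp (- M) * exp M" by (intro mult_strict_left_mono) auto
  finally show "exp (t * l) * N < 1" by (simp add: exp_minus)
qed

text \<open>At \<open>t \<rightarrow> -\<infinity>\<close> only prefixes of length zero survive; after removing the common prefix, the first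
letters of the two sides witness that they do not cancel.\<close>

lemma occ_diff_nonzero:
  assumes "u \<noteq> v" "\<And>x. 0 \<le> L x" "\<And>x y. L x = 0 \<Longrightarrow> L y = 0 \<Longrightarrow> x = y"
  shows "\<exists>x t0. \<forall>t\<le>t0. occ_diff (u, v) x (\<lambda>x. t * L x) \<noteq> 0"
  using assms(1)
proof (induction u arbitrary: v)
  case Nil
  then obtain y v' where v: "v = y # v'" by (cases v) auto
  have "occ_diff ([], v) y (\<lambda>x. t * L x) < 0" for t
    using mult_nonneg_nonneg[OF exp_ge_zero occ_sum_nonneg, of "t * L y" v' y "\<lambda>x. t * L x"]
    unfolding v occ_diff_def by simp
  then show ?case by (metis less_irrefl)
next
  case (Cons x u)
  show ?case
  proof (cases v)
    case Nil
    have "occ_diff (x # u, v) x (\<lambda>x. t * L x) > 0" for t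
      unfolding Nil occ_diff_def by (simp add: add_pos_nonneg occ_sum_nonneg)
    then show ?thesis by (metis less_irrefl)
  next
    case v: (Cons y v')
    have first: "\<exists>t0. \<forall>t\<le>t0. exp (t * L b) * occ_sum w a (\<lambda>x. t * L x) < 1" if "L b > 0" for a b w
    proof -
      obtain t0 where t0: "t0 \<le> 0" "\<And>t. t \<le> t0 \<Longrightarrow> exp (t * L b) * length w < 1"
        using exp_small[OF \<open>L b > 0\<close>] by metis
      have "exp (t * L b) * occ_sum w a (\<lambda>x. t * L x) < 1" if "t \<le> t0" for t
      proof -
        have "occ_sum w a (\<lambda>x. t * L x) \<le> length w"
          using that t0(1) assms(2) by (intro occ_sum_le_length) (simp add: mult_nonpos_nonneg)
        then have "exp (t * L b) * occ_sum w a (\<lambda>x. t * L x) \<le> exp (t * L b) * length w"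
          by (intro mult_left_mono) auto
        also have "\<dots> < 1" using t0(2)[OF that] .
        finally show ?thesis .
      qed
      then show ?thesis by blast
    qed
    consider "x = y" | "x \<noteq> y" "L y > 0" | "x \<noteq> y" "L x > 0"
      using assms(2)[of x] assms(2)[of y] assms(3)[of x y] by force
    then show ?thesis
    proof cases
      case 1
      then have "u \<noteq> v'" using Cons.prems v by simp
      then obtain z t0 where "\<forall>t\<le>t0. occ_diff (u, v') z (\<lambda>x. t * L x) \<noteq> 0" using Cons.IH by blast
      moreover have "occ_diff (x # u, v) z (\<lambda>x. t * L x) = exp (t * L x) * occ_diff (u, v') z (\<lambda>x. t * L x)" for t
        using 1 v by (simp add: occ_diff_def algebra_simps)
      ultimately show ?thesis by (metis exp_not_eq_zero mult_eq_0_iff)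
    next
      case 2
      obtain t0 where t0: "\<forall>t\<le>t0. exp (t * L y) * occ_sum v' x (\<lambda>x. t * L x) < 1"
        using first[OF 2(2)] by blast
      have "occ_diff (x # u, v) x (\<lambda>x. t * L x) > 0" if "t \<le> t0" for t
      proof -
        have "0 \<le> exp (t * L x) * occ_sum u x (\<lambda>x. t * L x)"
          by (intro mult_nonneg_nonneg) (auto simp: occ_sum_nonneg)
        moreover have "exp (t * L y) * occ_sum v' x (\<lambda>x. t * L x) < 1" using t0 that by blast
        ultimately show ?thesis using 2(1) v by (simp add: occ_diff_def)
      qed
      then show ?thesis by (metis less_irrefl)
    next
      case 3
      obtain t0 where t0: "\<forall>t\<le>t0. exp (t * L x) * occ_sum u y (\<lambda>x. t * L x) < 1"
        using first[OF 3(2)] by blast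
      have "occ_diff (x # u, v) y (\<lambda>x. t * L x) < 0" if "t \<le> t0" for t
      proof -
        have "0 \<le> exp (t * L y) * occ_sum v' y (\<lambda>x. t * L x)"
          by (intro mult_nonneg_nonneg) (auto simp: occ_sum_nonneg)
        moreover have "exp (t * L x) * occ_sum u y (\<lambda>x. t * L x) < 1" using t0 that by blast
        ultimately show ?thesis using 3(1) v by (simp add: occ_diff_def)
      qed
      then show ?thesis by (metis less_irrefl)
    qed
  qed
qed

lemma word_sum_nonneg: "(\<And>b. 0 \<le> d b) \<Longrightarrow> 0 \<le> word_sum d c w"
  by (induction w) (auto intro!: add_nonneg_nonneg)

lemma word_sum_le_weight:
  assumes "\<And>b. 0 \<le> d b" "\<And>b. c b \<le> 0"
  shows "word_sum d c w \<le> weight d w"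
proof (induction w)
  case (Cons b w)
  have "exp (c b) * word_sum d c w \<le> 1 * weight d w"
    using Cons assms word_sum_nonneg[of d c w] by (intro mult_mono) auto
  then show ?case by simp
qed simp

text \<open>For very negative \<open>t\<close> all letters but the first contribute less than 1, so
  integer letter weights reveal the first letter. The shift by 1 makes weights positive and tells
  the empty word from nonempty ones.\<close>

lemma word_sum_injective:
  fixes v w :: "nat list"
  assumes "\<And>t. t \<le> t0 \<Longrightarrow> word_sum (\<lambda>b. real b + 1) (\<lambda>b. t) v = word_sum (\<lambda>b. real b + 1) (\<lambda>b. t) w"
  shows "v = w"
  using assms
proof (induction v arbitrary: w)
  case Nil
  show ?case
  proof (cases w)
    case (Cons b w')
    have "0 \<le> exp t0 * word_sum (\<lambda>b. real b + 1) (\<lambda>b. t0) w'"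
      by (intro mult_nonneg_nonneg word_sum_nonneg) auto
    then show ?thesis using Nil[of t0] Cons by simp
  qed simp
next
  case (Cons a v)
  let ?word_sum = "\<lambda>t. word_sum (\<lambda>b. real b + 1) (\<lambda>b. t)"
  have nn: "0 \<le> ?word_sum t w" for t w by (intro word_sum_nonneg) auto
  obtain b w' where w: "w = b # w'"
  proof (cases w)
    case Nil
    have "0 \<le> exp t0 * ?word_sum t0 v" by (intro mult_nonneg_nonneg word_sum_nonneg) auto
    then show ?thesis using Cons.prems[of t0] Nil by simp
  qed
  have eq: "real a + exp t * ?word_sum t v = real b + exp t * ?word_sum t w'" if "t \<le> t0" for t
    using Cons.prems[OF that] w by simp
  define N where "N = weight (\<lambda>b. real b + 1) v + weight (\<lambda>b. real b + 1) w'"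
  obtain t1 where t1: "t1 \<le> 0" "\<And>t. t \<le> t1 \<Longrightarrow> exp (t * 1) * N < 1"
    using exp_small[of 1 N] by auto
  define t where "t = min t0 t1"
  have "?word_sum t v \<le> weight (\<lambda>b. real b + 1) v" "?word_sum t w' \<le> weight (\<lambda>b. real b + 1) w'"
    using t1(1) by (auto intro!: word_sum_le_weight simp: t_def)
  then have "exp t * ?word_sum t v + exp t * ?word_sum t w' \<le> exp t * N"
    unfolding N_def distrib_left[symmetric] by (intro mult_left_mono) auto
  also have "\<dots> < 1" using t1(2)[of t] by (simp add: t_def)
  finally have "\<bar>real a - real b\<bar> < 1"
    using eq[of t] nn[of t v] nn[of t w'] by (simp add: t_def) (smt (verit) exp_ge_zero mult_nonneg_nonneg)
  then have "a = b" by linarith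
  moreover have "?word_sum t v = ?word_sum t w'" if "t \<le> t0" for t
    using eq[OF that] \<open>a = b\<close> by simp
  ultimately show ?case using Cons.IH w by blast
qed

section \<open>Erased unknowns and transfer of solutions\<close>

lemma weight_space_erased_nth:
  assumes "L \<in> weight_space h" "h x = []"
  shows "L $ x = 0"
proof -
  obtain d where "\<forall>x. L $ x = weight d (h x)" using assms(1) unfolding weight_space_def by blast
  then show ?thesis using assms(2) by simp
qed

text \<open>For any \<open>x\<close> other than \<open>t0\<close> the weight space contains a vector
  with coordinate 1 at \<open>x\<close>. Thus a morphism of rank \<open>n - 1\<close> erases at most
  one unknown, as \<open>occ_diff_nonzero\<close> requires.\<close>

lemma erased_unique:
  fixes h :: "'x::finite \<Rightarrow> 'b list"
  assumes "a $ t0 = 1" "weight_space h = {L. a \<bullet> L = 0}" "h x = []"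
  shows "x = t0"
proof (rule ccontr)
  assume "x \<noteq> t0"
  let ?v = "\<chi> y. (if y = x then 1 else 0) - (if y = t0 then a $ x else 0)"
  have "?v $ x = 0" using axis_diff_in_weight_space[OF assms(1,2)] weight_space_erased_nth assms(3) by blast
  then show False using \<open>x \<noteq> t0\<close> by simp
qed

text \<open>Every letter gets the weight \<open>t\<close>. For very negative \<open>t\<close> the
  vector of \<open>E1\<close> is nonzero, so vanishing minors make that of \<open>E2\<close> a
  multiple of it; the word sums of the two sides of \<open>E2\<close> then agree for all
  \<open>t \<le> t1\<close>, which identifies the images.\<close>

lemma solution_transfer:
  fixes h :: "'x::finite \<Rightarrow> nat list"
  assumes "rank h = card (UNIV :: 'x set) - 1" "fst E1 \<noteq> snd E1"
    and "morph h (fst E1) = morph h (snd E1)"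
    and "\<And>L k l. L \<in> weight_space h \<Longrightarrow> minor E1 E2 k l (($) L) = 0"
  shows "morph h (fst E2) = morph h (snd E2)"
proof -
  obtain a :: "real ^ 'x" and t0 where a: "a $ t0 = 1" "weight_space h = {L. a \<bullet> L = 0}"
    using weight_space_eq_hyperplane[OF assms(1)] .
  define l where "l x = real (length (h x))" for x
  have l: "weight (\<lambda>b. t) (h x) = t * l x" for t x
    by (simp add: weight_def l_def sum_list_triv)
  have "\<exists>x t1. \<forall>t\<le>t1. occ_diff (fst E1, snd E1) x (\<lambda>x. t * l x) \<noteq> 0"
    using erased_unique[OF a] by (intro occ_diff_nonzero assms(2)) (auto simp: l_def)
  then obtain x t1 where x: "\<And>t. t \<le> t1 \<Longrightarrow> occ_diff E1 x (\<lambda>x. t * l x) \<noteq> 0" by auto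
  show ?thesis
  proof (rule word_sum_injective[of t1])
    fix t assume t: "t \<le> t1"
    let ?L = "\<lambda>x. t * l x" and ?d = "\<lambda>b. real b + 1"
    have "(\<chi> x. t * l x) \<in> weight_space h" unfolding weight_space_def
      by (auto simp: l intro!: exI[of _ "\<lambda>b. t"])
    then have "minor E1 E2 x y ?L = 0" for y
      using assms(4)[of "\<chi> x. t * l x" x y] by (simp add: vec_lambda_inverse)
    then have m: "occ_diff E1 x ?L * occ_diff E2 y ?L = occ_diff E2 x ?L * occ_diff E1 y ?L" for y
      by (simp add: minor_def mult.commute)
    have "occ_diff E1 x ?L * (\<Sum>y\<in>UNIV. occ_diff E2 y ?L * word_sum ?d (\<lambda>b. t) (h y))
        = occ_diff E2 x ?L * (\<Sum>y\<in>UNIV. occ_diff E1 y ?L * word_sum ?d (\<lambda>b. t) (h y))"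
      unfolding sum_distrib_left mult.assoc[symmetric] m ..
    also have "\<dots> = 0"
      using sum_occ_diff_word_sum[of E1 "\<lambda>b. t" h ?d] assms(3) by (simp add: l)
    finally show "word_sum ?d (\<lambda>b. t) (morph h (fst E2)) = word_sum ?d (\<lambda>b. t) (morph h (snd E2))"
      using sum_occ_diff_word_sum[of E2 "\<lambda>b. t" h ?d] x[OF t] by (simp add: l)
  qed
qed

text \<open>The equation with \<open>z\<close> deleted is still solved, and its vector is zero at
  \<open>z\<close>, which is the coordinate \<open>t0\<close>. Orthogonality makes the vector vanish
  near 0 and hence for all \<open>t\<close>, impossible for a nontrivial equation.\<close>

lemma erasing_solution:
  fixes h :: "'x::finite \<Rightarrow> nat list"
  assumes "rank h = card (UNIV :: 'x set) - 1" "h z = []"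
    and "morph h (fst E) = morph h (snd E)"
  shows "filter (\<lambda>x. x \<noteq> z) (fst E) = filter (\<lambda>x. x \<noteq> z) (snd E)"
proof (rule ccontr)
  let ?u = "filter (\<lambda>x. x \<noteq> z) (fst E)" and ?v = "filter (\<lambda>x. x \<noteq> z) (snd E)"
  assume "?u \<noteq> ?v"
  obtain a :: "real ^ 'x" and t0 where a: "a $ t0 = 1" "weight_space h = {L. a \<bullet> L = 0}"
    using weight_space_eq_hyperplane[OF assms(1)] .
  have z: "t0 = z" using erased_unique[OF a assms(2)] by simp
  define l where "l x = real (length (h x))" for x
  have l: "weight (\<lambda>b. t) (h x) = t * l x" for t x
    by (simp add: weight_def l_def sum_list_triv)
  have "\<exists>x t1. \<forall>t\<le>t1. occ_diff (?u, ?v) x (\<lambda>x. t * l x) \<noteq> 0"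
    using erased_unique[OF a] by (intro occ_diff_nonzero \<open>?u \<noteq> ?v\<close>) (auto simp: l_def)
  then obtain x t1 where x: "\<And>t. t \<le> t1 \<Longrightarrow> occ_diff (?u, ?v) x (\<lambda>x. t * l x) \<noteq> 0" by auto
  have "morph h (filter (\<lambda>x. x \<noteq> z) w) = morph h w" for w
    using assms(2) by (induction w) (auto simp: morph_def)
  then have sol: "morph h ?u = morph h ?v" using assms(3) by simp
  have "occ_sum (filter (\<lambda>x. x \<noteq> z) w) z L = 0" for w L by (induction w) auto
  then have Rz: "occ_diff (?u, ?v) z L = 0" for L by (simp add: occ_diff_def)
  obtain \<delta> :: real where \<delta>: "\<delta> > 0"
    "\<And>t R y. \<lbrakk>\<bar>t\<bar> < \<delta>; R t0 = 0;
        \<And>d. (\<Sum>x\<in>UNIV. R x * word_sum d (\<lambda>b. t * 1) (h x)) = 0\<rbrakk> \<Longrightarrow> R y = (0::real)"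
    using orthogonal_word_sum_eq_0[OF a, where c = "\<lambda>_. 1"] by metis
  have near: "occ_diff (?u, ?v) x (\<lambda>x. t * l x) = 0" if "\<bar>t\<bar> < \<delta>" for t
  proof (rule \<delta>(2)[OF that, of "\<lambda>x. occ_diff (?u, ?v) x (\<lambda>x. t * l x)"])
    fix d
    show "(\<Sum>x\<in>UNIV. occ_diff (?u, ?v) x (\<lambda>x. t * l x) * word_sum d (\<lambda>b. t * 1) (h x)) = 0"
      using sum_occ_diff_word_sum[of "(?u, ?v)" "\<lambda>b. t" h d] sol by (simp add: l)
  qed (simp add: Rz z)
  have "occ_diff (?u, ?v) x (\<lambda>x. t * l x)
      = (\<Sum>j\<in>occs (?u, ?v) x. side_sign (fst j) * exp (t * weight l (snd j)))" for t
    by (simp add: occ_diff_eq_sum case_prod_unfold)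
  then have "occ_diff (?u, ?v) x (\<lambda>x. t1 * l x) = 0"
    using exp_sum_zero_extend[OF finite_occs[of "(?u, ?v)" x] \<delta>(1),
        of "\<lambda>j. side_sign (fst j)" "\<lambda>j. weight l (snd j)" t1]
      near by simp
  then show False using x by blast
qed

text \<open>Consequently erasing morphisms with distinct weight spaces erase distinct
  unknowns.\<close>

lemma weight_space_of_erasing:
  fixes h :: "'x::finite \<Rightarrow> nat list"
  assumes "rank h = card (UNIV :: 'x set) - 1" "h z = []"
  shows "weight_space h = {L. L $ z = 0}"
proof -
  obtain a :: "real ^ 'x" and t0 where a: "a $ t0 = 1" "weight_space h = {L. a \<bullet> L = 0}"
    using weight_space_eq_hyperplane[OF assms(1)] .
  have z: "t0 = z" using erased_unique[OF a assms(2)] by simp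
  have "a $ s = 0" if "s \<noteq> z" for s
  proof -
    let ?v = "\<chi> y. (if y = s then 1 else 0) - (if y = t0 then a $ s else 0)"
    have "?v $ z = 0" using axis_diff_in_weight_space[OF a] weight_space_erased_nth assms(2) by blast
    then show ?thesis using that z by simp
  qed
  then have "a \<bullet> L = (\<Sum>y\<in>UNIV. if y = z then L $ y else 0)" for L
    unfolding inner_vec_def using a(1) z by (intro sum.cong) auto
  then show ?thesis using a(2) by simp
qed

section \<open>Counting common solutions\<close>

text \<open>Prefixes are taken up to permutation, because \<open>exp (weight L p)\<close> depends
  only on the letter counts of \<open>p\<close>.\<close>

definition prefix_counts :: "'x eqn \<Rightarrow> 'x \<Rightarrow> 'x \<Rightarrow> ('x \<Rightarrow> nat) set" where
  "prefix_counts E k l = (\<lambda>(b, p). count_list p) ` (occs E k \<union> occs E l)"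

lemma occs_comparable:
  assumes "(b, p) \<in> occs E k" "(b, q) \<in> occs E l"
  shows "(\<forall>x. count_list p x \<le> count_list q x) \<or> (\<forall>x. count_list q x \<le> count_list p x)"
proof -
  obtain r s where "side E b = p @ k # r" "side E b = q @ l # s"
    using assms by (auto simp: occs_def set_occ_prefixes)
  then have "p @ k # r = q @ l # s" by simp
  then obtain z where "p = q @ z \<or> q = p @ z" by (auto simp: append_eq_append_conv2)
  then show ?thesis by auto
qed

lemma card_prefix_counts: "card (prefix_counts E k l) \<le> eq_occ E k + eq_occ E l"
proof -
  have "card (prefix_counts E k l) \<le> card (occs E k \<union> occs E l)"
    unfolding prefix_counts_def by (intro card_image_le) simp
  also have "\<dots> \<le> card (occs E k) + card (occs E l)" by (rule card_Un_le)
  finally show ?thesis by (simp add: card_occs)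
qed

text \<open>The two occurrences after the longest common prefix of the sides have the same prefix.\<close>

lemma card_prefix_counts_mismatch:
  assumes "fst E = c @ x # r" "snd E = c @ y # r'" "{x, y} = {k, l}"
  shows "card (prefix_counts E k l) + 1 \<le> eq_occ E k + eq_occ E l"
proof -
  let ?P = "occs E k \<union> occs E l"
  have "(True, c) \<in> occs E x" "(False, c) \<in> occs E y"
    using assms(1,2) by (auto simp: occs_def side_def set_occ_prefixes)
  then have T: "(True, c) \<in> ?P" and F: "(False, c) \<in> ?P" using assms(3) by (auto simp: doubleton_eq_iff)
  have "prefix_counts E k l \<subseteq> (\<lambda>(b, p). count_list p) ` (?P - {(False, c)})"
  proof
    fix f assume "f \<in> prefix_counts E k l"
    then obtain b p where bp: "(b, p) \<in> ?P" "f = count_list p" by (auto simp: prefix_counts_def)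
    show "f \<in> (\<lambda>(b, p). count_list p) ` (?P - {(False, c)})"
    proof (cases "(b, p) = (False, c)")
      case True
      then show ?thesis using bp T by (intro image_eqI[of _ _ "(True, c)"]) auto
    next
      case False
      then show ?thesis using bp by (intro image_eqI[of _ _ "(b, p)"]) auto
    qed
  qed
  then have "card (prefix_counts E k l) \<le> card ((\<lambda>(b, p). count_list p) ` (?P - {(False, c)}))"
    by (intro card_mono) auto
  also have "\<dots> \<le> card (?P - {(False, c)})"
    by (intro card_image_le) simp
  also have "\<dots> = card ?P - 1" using F by (subst card_Diff_singleton) auto
  finally have "card (prefix_counts E k l) + 1 \<le> card ?P"
    using F by (metis Nat.le_diff_conv2 One_nat_def Suc_leI card_gt_0_iff empty_iff finite_UnI finite_occs)
  also have "\<dots> \<le> card (occs E k) + card (occs E l)" by (rule card_Un_le)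
  finally show ?thesis by (simp add: card_occs)
qed

text \<open>A chain consists of the products of a fixed term from \<open>E1\<close> with the terms from one side of \<open>E2\<close>.\<close>

lemma card_hyperplanes_less_prefix_counts:
  fixes A :: "(real ^ 'x::finite) set"
  assumes "finite A" "inj_on (\<lambda>a. {L. a \<bullet> L = 0}) A"
    and "\<And>a. a \<in> A \<Longrightarrow> a \<noteq> 0 \<and> (\<exists>p. (\<forall>x. 0 < p $ x) \<and> a \<bullet> p = 0)"
    and "\<And>a L. a \<in> A \<Longrightarrow> a \<bullet> L = 0 \<Longrightarrow> minor E1 E2 k l (($) L) = 0"
    and "minor E1 E2 k l (($) L0) \<noteq> 0"
  shows "card A + 1 \<le> 2 * card (prefix_counts E1 k l)"
proof -
  define \<kappa> :: "bool \<times> (bool \<times> 'x list) \<times> (bool \<times> 'x list) \<Rightarrow> ('x \<Rightarrow> nat) \<times> bool"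
    where "\<kappa> = (\<lambda>(s, (b, p), (c, q)). (count_list p, c))"
  have "card A + 1 \<le> card (\<kappa> ` pairs E1 E2 k l)"
  proof (rule card_hyperplanes_less_chains[of "pairs E1 E2 k l" A pair_side_sign pair_word L0])
    fix i j assume ij: "i \<in> pairs E1 E2 k l" "j \<in> pairs E1 E2 k l" "\<kappa> i = \<kappa> j"
    obtain s b p c q where i: "i = (s, (b, p), (c, q))" by (metis prod.collapse)
    obtain s' b' p' c' q' where j: "j = (s', (b', p'), (c', q'))" by (metis prod.collapse)
    have "count_list p = count_list p'" "c = c'" using ij(3) by (auto simp: i j \<kappa>_def)
    moreover obtain m m' where "(c, q) \<in> occs E2 m" "(c', q') \<in> occs E2 m'"
      using ij(1,2) by (auto simp: i j pairs_def)
    ultimately show "(\<forall>x. count_list (pair_word i) x \<le> count_list (pair_word j) x)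
        \<or> (\<forall>x. count_list (pair_word j) x \<le> count_list (pair_word i) x)"
      using occs_comparable[of c q E2 m q' m'] by (simp add: i j)
  qed (use assms in \<open>auto simp: minor_eq_sum[symmetric]\<close>)
  also have "\<dots> \<le> card (prefix_counts E1 k l \<times> (UNIV :: bool set))"
  proof (intro card_mono image_subsetI)
    fix j assume j: "j \<in> pairs E1 E2 k l"
    obtain s b p c q where eq: "j = (s, (b, p), (c, q))" by (metis prod.collapse)
    have "(b, p) \<in> occs E1 k \<union> occs E1 l" using j by (auto simp: eq pairs_def)
    then have "count_list p \<in> prefix_counts E1 k l"
      unfolding prefix_counts_def by (rule rev_image_eqI) simp
    then show "\<kappa> j \<in> prefix_counts E1 k l \<times> UNIV" by (simp add: eq \<kappa>_def)
  qed (simp add: prefix_counts_def)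
  also have "\<dots> = 2 * card (prefix_counts E1 k l)"
    by (simp add: card_cartesian_product)
  finally show ?thesis .
qed

lemma minor_swap: "minor E2 E1 k l L = - minor E1 E2 k l L"
  by (simp add: minor_def)

text \<open>At the first mismatch one of the two differing letters must be deleted. If one side is a
  proper prefix of the other, only the first surplus letter qualifies.\<close>

lemma mismatch_cases:
  assumes "u \<noteq> v"
  defines "Z \<equiv> {z. filter (\<lambda>i. i \<noteq> z) u = filter (\<lambda>i. i \<noteq> z) v}"
  shows "(\<exists>c x y r r'. x \<noteq> y \<and> u = c @ x # r \<and> v = c @ y # r' \<and> Z \<subseteq> {x, y}) \<or> (\<exists>y. Z \<subseteq> {y})"
  using assms(1) unfolding Z_def
proof (induction u arbitrary: v)
  case Nil
  then obtain y v' where "v = y # v'" by (cases v) auto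
  then show ?case by (intro disjI2 exI[of _ y]) auto
next
  case (Cons x u)
  show ?case
  proof (cases v)
    case Nil
    then show ?thesis by (intro disjI2 exI[of _ x]) auto
  next
    case v: (Cons y v')
    show ?thesis
    proof (cases "x = y")
      case True
      let ?Z = "{z. filter (\<lambda>i. i \<noteq> z) u = filter (\<lambda>i. i \<noteq> z) v'}"
      have Z: "{z. filter (\<lambda>i. i \<noteq> z) (x # u) = filter (\<lambda>i. i \<noteq> z) v} = ?Z"
        using True v by auto
      have "u \<noteq> v'" using Cons.prems True v by simp
      then consider c a b r r' where "a \<noteq> b" "u = c @ a # r" "v' = c @ b # r'" "?Z \<subseteq> {a, b}"
        | y where "?Z \<subseteq> {y}" using Cons.IH by blast
      then show ?thesis
      proof cases
        case 1
        then show ?thesis unfolding Z using True v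
          by (intro disjI1 exI[of _ "x # c"] exI[of _ a] exI[of _ b] exI[of _ r] exI[of _ r']) simp
      qed (use Z in auto)
    next
      case False
      then have "{z. filter (\<lambda>i. i \<noteq> z) (x # u) = filter (\<lambda>i. i \<noteq> z) v} \<subseteq> {x, y}"
        using v by auto
      then show ?thesis using False v
        by (intro disjI1 exI[of _ "[]"] exI[of _ x] exI[of _ y] exI[of _ u] exI[of _ v']) simp
    qed
  qed
qed

text \<open>Two erasable unknowns must be the two letters at the first mismatch. The saved prefix
  count will pay for the second erasing solution.\<close>

lemma two_erasing:
  fixes E :: "'x::finite eqn"
  assumes "fst E \<noteq> snd E" "1 < card Z"
    and filt: "\<And>z. z \<in> Z \<Longrightarrow> filter (\<lambda>i. i \<noteq> z) (fst E) = filter (\<lambda>i. i \<noteq> z) (snd E)"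
  obtains x y where "x \<noteq> y" "Z = {x, y}"
    "\<And>z L. z \<notin> Z \<Longrightarrow> occ_diff E z L = 0"
    "\<And>k l. {k, l} = Z \<Longrightarrow> card (prefix_counts E k l) + 1 \<le> eq_occ E k + eq_occ E l"
proof -
  let ?Z = "{z. filter (\<lambda>i. i \<noteq> z) (fst E) = filter (\<lambda>i. i \<noteq> z) (snd E)}"
  have sub: "Z \<subseteq> ?Z" using filt by auto
  have "\<not> Z \<subseteq> {y}" for y
    using assms(2) card_mono[of "{y}" Z] by auto
  then have "\<not> (\<exists>y. ?Z \<subseteq> {y})" using sub by (meson subset_trans)
  then obtain c x y r r' where m: "x \<noteq> y" "fst E = c @ x # r" "snd E = c @ y # r'" "?Z \<subseteq> {x, y}"
    using mismatch_cases[OF assms(1)] by (elim disjE exE conjE) (rule that, assumption+, blast)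
  have "Z \<subseteq> {x, y}" using sub m(4) by (rule subset_trans)
  moreover have "card {x, y} \<le> card Z" using m(1) assms(2) by simp
  ultimately have Z: "Z = {x, y}" by (intro card_seteq) simp_all
  show thesis
  proof (rule that[OF m(1) Z])
    fix z L assume "z \<notin> Z"
    then show "occ_diff E z L = 0"
      using occ_sum_eq_if_filters_eq[OF filt filt m(1), of z L] Z by (simp add: occ_diff_def)
  next
    fix k l assume "{k, l} = Z"
    then show "card (prefix_counts E k l) + 1 \<le> eq_occ E k + eq_occ E l"
      using card_prefix_counts_mismatch[OF m(2,3)] Z by simp
  qed
qed

text \<open>Nonerasing solutions give hyperplanes meeting the positive orthant; erasing ones are
  counted by the unknown they erase. Swapping \<open>E1\<close> and \<open>E2\<close> only changes
  the sign of the minor, whence both bounds.\<close>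

lemma card_solutions_le:
  fixes E1 E2 :: "'x::finite eqn" and H :: "('x \<Rightarrow> nat list) set"
  assumes ne: "fst E1 \<noteq> snd E1" "fst E2 \<noteq> snd E2"
    and H: "finite H" "inj_on weight_space H"
    and rk: "\<And>h. h \<in> H \<Longrightarrow> rank h = card (UNIV :: 'x set) - 1"
    and sol: "\<And>h. h \<in> H \<Longrightarrow> morph h (fst E1) = morph h (snd E1) \<and> morph h (fst E2) = morph h (snd E2)"
    and nz: "minor E1 E2 k l (($) L0) \<noteq> 0"
  shows "card H \<le> 2 * (eq_occ E1 k + eq_occ E1 l) \<and> card H \<le> 2 * (eq_occ E2 k + eq_occ E2 l)"
proof -
  define H0 where "H0 = {h \<in> H. \<forall>x. h x \<noteq> []}"
  define H1 where "H1 = {h \<in> H. \<exists>x. h x = []}"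
  have fin: "finite H0" "finite H1" 
    using finite_subset[OF _ H(1), of H0] finite_subset[OF _ H(1), of H1]
    unfolding H0_def H1_def by blast+
  have cardH: "card H = card H0 + card H1"
  proof -
    have "H = H0 \<union> H1" "H0 \<inter> H1 = {}" by (auto simp: H0_def H1_def)
    then show ?thesis using card_Un_disjoint[OF fin] by simp
  qed
  have "\<forall>h\<in>H. \<exists>a :: real ^ 'x. a \<noteq> 0 \<and> weight_space h = {L. a \<bullet> L = 0}"
    using weight_space_eq_hyperplane[OF rk] by (metis zero_index zero_neq_one)
  then obtain a :: "('x \<Rightarrow> nat list) \<Rightarrow> real ^ 'x"
    where a: "\<And>h. h \<in> H \<Longrightarrow> a h \<noteq> 0" "\<And>h. h \<in> H \<Longrightarrow> weight_space h = {L. a h \<bullet> L = 0}" by metis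
  have inj_a: "inj_on (\<lambda>h. {L. a h \<bullet> L = 0}) H0"
    using H(2) a(2) by (auto simp: inj_on_def H0_def)
  then have "inj_on a H0" by (auto simp: inj_on_def)
  have minor0: "minor E E' k l (($) L) = 0"
    if "h \<in> H" "L \<in> weight_space h" "(E, E') = (E1, E2) \<or> (E, E') = (E2, E1)" for h L E E'
  proof -
    have "morph h (fst E) = morph h (snd E)" "morph h (fst E') = morph h (snd E')"
      using sol[OF that(1)] that(3) by auto
    then show ?thesis by (rule minor_eq_0_on_weight_space[OF rk[OF that(1)] _ _ that(2)])
  qed
  have bound0: "card H0 + 1 \<le> 2 * card (prefix_counts E k l)"
    if E: "(E, E') = (E1, E2) \<or> (E, E') = (E2, E1)" for E E'
  proof -
    have "card (a ` H0) + 1 \<le> 2 * card (prefix_counts E k l)"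
    proof (rule card_hyperplanes_less_prefix_counts[of _ E E' k l L0])
      show "inj_on (\<lambda>b. {L. b \<bullet> L = 0}) (a ` H0)"
        using inj_a by (auto simp: inj_on_def)
      fix b assume "b \<in> a ` H0"
      then obtain h where h: "h \<in> H0" "b = a h" by auto
      then have hH: "h \<in> H" by (simp add: H0_def)
      \<comment> \<open>The image lengths form a positive point of the hyperplane, since members of
        \<open>H0\<close> erase nothing.\<close>
      have "(\<chi> x. weight (\<lambda>_. 1) (h x)) \<in> weight_space h" unfolding weight_space_def
        by (auto intro!: exI[of _ "\<lambda>_. 1"])
      moreover have "0 < weight (\<lambda>_. 1) (h x)" for x
        using h(1) by (simp add: H0_def weight_def sum_list_triv)
      ultimately show "b \<noteq> 0 \<and> (\<exists>p. (\<forall>x. 0 < p $ x) \<and> b \<bullet> p = 0)"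
        using a[OF hH] h(2) by (intro conjI exI[of _ "\<chi> x. weight (\<lambda>_. 1) (h x)"]) auto
      fix L assume "b \<bullet> L = 0"
      then show "minor E E' k l (($) L) = 0"
        using minor0[OF hH _ E] a(2)[OF hH] h(2) by simp
    next
      show "minor E E' k l (($) L0) \<noteq> 0" using nz minor_swap[of E2 E1 k l] E by auto
    qed (use fin in auto)
    then show ?thesis using \<open>inj_on a H0\<close> by (simp add: card_image)
  qed
  have "\<forall>h\<in>H1. \<exists>x. h x = []" by (simp add: H1_def)
  then obtain z where z: "\<And>h. h \<in> H1 \<Longrightarrow> h (z h) = []" by metis
  have "inj_on z H1"
  proof (rule inj_onI)
    fix g h assume gh: "g \<in> H1" "h \<in> H1" "z g = z h"
    then have "g \<in> H" "h \<in> H" by (auto simp: H1_def)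
    moreover have "weight_space g = weight_space h"
      using weight_space_of_erasing[OF rk[OF \<open>g \<in> H\<close>] z[OF gh(1)]] weight_space_of_erasing[OF rk[OF \<open>h \<in> H\<close>] z[OF gh(2)]]
        gh(3) by simp
    ultimately show "g = h" using H(2) by (simp add: inj_onD)
  qed
  then have card1: "card H1 = card (z ` H1)" by (simp add: card_image)
  have filt: "filter (\<lambda>i. i \<noteq> y) (fst E) = filter (\<lambda>i. i \<noteq> y) (snd E)"
    if y: "y \<in> z ` H1" and E: "E = E1 \<or> E = E2" for y E
  proof -
    obtain h where h: "h \<in> H1" "y = z h" using y by auto
    then have "h \<in> H" by (simp add: H1_def)
    then show ?thesis
      using erasing_solution[OF rk[OF \<open>h \<in> H\<close>] z[OF h(1)], of E] sol[OF \<open>h \<in> H\<close>] E h(2) by blast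
  qed
  have b: "card H0 + 1 \<le> 2 * card (prefix_counts E1 k l)" "card H0 + 1 \<le> 2 * card (prefix_counts E2 k l)"
    using bound0[of E1 E2] bound0[of E2 E1] by simp_all
  show ?thesis
  \<comment> \<open>One erasing solution is absorbed by the \<open>+ 1\<close> in \<open>b\<close>.
    Two are absorbed by the prefix count saved at the mismatch, which counts twice in
    \<open>b\<close>.\<close>
  proof (cases "card H1 \<le> 1")
    case True
    then show ?thesis
      using b card_prefix_counts[of E1 k l] card_prefix_counts[of E2 k l] cardH
      by simp
  next
    case False
    have kl: "k \<noteq> l" using nz by (auto simp: minor_def)
    have more: "1 < card (z ` H1)" using False card1 by linarith
    obtain x y where 1: "x \<noteq> y" "z ` H1 = {x, y}" "\<And>m L. m \<notin> z ` H1 \<Longrightarrow> occ_diff E1 m L = 0"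
      "\<And>k l. {k, l} = z ` H1 \<Longrightarrow> card (prefix_counts E1 k l) + 1 \<le> eq_occ E1 k + eq_occ E1 l"
      using two_erasing[OF ne(1) more filt] by blast
    have 2: "\<And>m L. m \<notin> z ` H1 \<Longrightarrow> occ_diff E2 m L = 0"
      "\<And>k l. {k, l} = z ` H1 \<Longrightarrow> card (prefix_counts E2 k l) + 1 \<le> eq_occ E2 k + eq_occ E2 l"
      by (rule two_erasing[OF ne(2) more filt]; blast)+
    \<comment> \<open>Outside \<open>{x, y}\<close> the vectors of both equations vanish, and a zero
      column would annihilate the minor.\<close>
    have "m \<in> {x, y}" if "m = k \<or> m = l" for m
    proof (rule ccontr)
      assume "m \<notin> {x, y}"
      then have "occ_diff E1 m L = 0" "occ_diff E2 m L = 0" for L using 1(2,3) 2(1) by auto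
      then show False using nz that by (auto simp: minor_def)
    qed
    then have "{k, l} = {x, y}" using kl by blast
    then have "card (prefix_counts E1 k l) + 1 \<le> eq_occ E1 k + eq_occ E1 l"
      "card (prefix_counts E2 k l) + 1 \<le> eq_occ E2 k + eq_occ E2 l"
      using 1(2,4) 2(2) by auto
    moreover have "card H1 = 2" using card1 1(1,2) by simp
    ultimately show ?thesis
      using b cardH by simp
  qed
qed

lemma eq_occ_add_le_eq_len:
  assumes "k \<noteq> l"
  shows "eq_occ E k + eq_occ E l \<le> eq_len E"
proof -
  have "count_list w k + count_list w l \<le> length w" for w
    using assms by (induction w) auto
  from this[of "fst E"] this[of "snd E"] show ?thesis
    unfolding eq_occ_def eq_len_def by linarith
qed

section \<open>From strong independence to distinct hyperplanes\<close>

theorem theorem4p9: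
  fixes Es :: "'x::finite eqn list"
  assumes "card (UNIV :: 'x set) \<ge> 2"
    and "length Es \<ge> 2"
    and "distinct Es"
    and "strongly_independent (set Es)"
  shows "length Es \<le> eq_len (Es ! 0) + eq_len (Es ! 1) + 2
       \<and> (\<exists>k l. k \<noteq> l \<and> length Es \<le> 2 * (eq_occ (Es ! 0) k + eq_occ (Es ! 0) l) + 2)
       \<and> ((\<exists>h :: 'x \<Rightarrow> nat list. is_solution h (set Es) \<and> rank h = card (UNIV :: 'x set) - 1) \<longrightarrow>
            length Es \<le> eq_len (Es ! 0) + eq_len (Es ! 1) + 1
          \<and> (\<exists>k l. k \<noteq> l \<and> length Es \<le> 2 * (eq_occ (Es ! 0) k + eq_occ (Es ! 0) l) + 1))"
proof -
  let ?m = "length Es"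
  define solves where "solves h E \<longleftrightarrow> morph h (fst E) = morph h (snd E)"
    for h :: "'x \<Rightarrow> nat list" and E :: "'x eqn"
  \<comment> \<open>Strong independence is applied to the subsystems that omit a single
    equation.\<close>
  have "\<exists>h :: 'x \<Rightarrow> nat list. rank h = card (UNIV :: 'x set) - 1 \<and> \<not> solves h (Es ! i)
      \<and> (\<forall>j<?m. j \<noteq> i \<longrightarrow> solves h (Es ! j))" if i: "i < ?m" for i
  proof -
    have "set Es - {Es ! i} \<subset> set Es" using nth_mem[OF i] by blast
    then obtain h :: "'x \<Rightarrow> nat list" where h: "is_solution h (set Es - {Es ! i})"
        "rank h = card (UNIV :: 'x set) - 1" "\<not> is_solution h (set Es)"
      using assms(4) unfolding strongly_independent_def by blast
    have all: "\<forall>E\<in>set Es - {Es ! i}. solves h E"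
      using h(1) unfolding is_solution_def solves_def .
    have "solves h (Es ! j)" if "j < ?m" "j \<noteq> i" for j
      using that i assms(3) nth_mem[OF that(1)] all by (metis DiffI nth_eq_iff_index_eq singletonD)
    moreover have "\<not> solves h (Es ! i)"
      using all h(3) unfolding is_solution_def solves_def by blast
    ultimately show ?thesis using h(2) by blast
  qed
  then obtain g :: "nat \<Rightarrow> 'x \<Rightarrow> nat list" where
    g: "\<And>i. i < ?m \<Longrightarrow> rank (g i) = card (UNIV :: 'x set) - 1"
       "\<And>i. i < ?m \<Longrightarrow> \<not> solves (g i) (Es ! i)"
       "\<And>i j. i < ?m \<Longrightarrow> j < ?m \<Longrightarrow> j \<noteq> i \<Longrightarrow> solves (g i) (Es ! j)"
    by metis
  let ?E1 = "Es ! 0" and ?E2 = "Es ! 1"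
  have m: "0 < ?m" "1 < ?m" using assms(2) by auto
  have ne: "fst ?E1 \<noteq> snd ?E1" "fst ?E2 \<noteq> snd ?E2"
    using g(2)[OF m(1)] g(2)[OF m(2)] by (auto simp: solves_def)
  \<comment> \<open>Otherwise \<open>g 1\<close>, which solves the first equation, would also solve
    the second.\<close>
  have "\<exists>L k l. minor ?E1 ?E2 k l (($) L) \<noteq> 0"
  proof (rule ccontr)
    assume "\<not> ?thesis"
    then have z: "minor ?E1 ?E2 k l (($) L) = 0" for k l L by blast
    have "solves (g 1) ?E1" using g(3)[OF m(2) m(1)] by simp
    then have "solves (g 1) ?E2"
      unfolding solves_def by (rule solution_transfer[OF g(1)[OF m(2)] ne(1)]) (rule z)
    then show False using g(2)[OF m(2)] by blast
  qed
  then obtain k l L0 where nz: "minor ?E1 ?E2 k l (($) L0) \<noteq> 0" by blast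
  have kl: "k \<noteq> l" using nz by (auto simp: minor_def)
  \<comment> \<open>If the spaces coincided, the minors of the first equation and
    \<open>Es ! j\<close> would vanish on that of \<open>g j\<close>, and \<open>g j\<close> would
    solve \<open>Es ! j\<close>.\<close>
  have weight_space_ne: "weight_space h \<noteq> weight_space (g j)"
    if h: "rank h = card (UNIV :: 'x set) - 1" "solves h ?E1" "solves h (Es ! j)"
      and j: "j \<in> {2..<?m}" for h j
  proof
    assume eq: "weight_space h = weight_space (g j)"
    have jm: "j < ?m" "0 \<noteq> j" using j by auto
    have z: "minor ?E1 (Es ! j) k l (($) L) = 0" if "L \<in> weight_space (g j)" for k l L
      using h(2,3) that unfolding solves_def eq[symmetric] by (rule minor_eq_0_on_weight_space[OF h(1)])
    have "solves (g j) ?E1" using g(3)[OF jm(1) m(1)] jm(2) by simp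
    then have "solves (g j) (Es ! j)"
      unfolding solves_def by (rule solution_transfer[OF g(1)[OF jm(1)] ne(1)]) (rule z)
    then show False using g(2)[OF jm(1)] by blast
  qed
  have bound: "card H \<le> eq_len ?E1 + eq_len ?E2 \<and> card H \<le> 2 * (eq_occ ?E1 k + eq_occ ?E1 l)"
    if H: "finite H" "inj_on weight_space H" "\<And>h. h \<in> H \<Longrightarrow> rank h = card (UNIV :: 'x set) - 1"
      "\<And>h. h \<in> H \<Longrightarrow> solves h ?E1 \<and> solves h ?E2" for H
  proof -
    have "card H \<le> 2 * (eq_occ ?E1 k + eq_occ ?E1 l) \<and> card H \<le> 2 * (eq_occ ?E2 k + eq_occ ?E2 l)"
      using H(4) unfolding solves_def by (intro card_solutions_le[OF ne H(1-3) _ nz])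
    \<comment> \<open>The bound by the lengths is the average of the bounds from the two
      equations.\<close>
    then show ?thesis
      using eq_occ_add_le_eq_len[OF kl, of ?E1] eq_occ_add_le_eq_len[OF kl, of ?E2] by simp
  qed
  \<comment> \<open>The morphisms \<open>g 0\<close> and \<open>g 1\<close> each fail one of the
    first two equations; leaving them out accounts for the final \<open>+ 2\<close>.\<close>
  let ?H = "g ` {2..<?m}"
  have inj_g: "weight_space (g i) \<noteq> weight_space (g j)" if "i \<in> {2..<?m}" "j \<in> {2..<?m}" "i \<noteq> j" for i j
    using weight_space_ne[OF g(1) g(3) g(3)] that m by auto
  have "inj_on g {2..<?m}"
    using inj_g by (intro inj_onI) metis
  have inj_H: "inj_on weight_space ?H"
  proof (rule inj_onI)
    fix x y assume "x \<in> ?H" "y \<in> ?H" "weight_space x = weight_space y"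
    then obtain i j where "i \<in> {2..<?m}" "x = g i" "j \<in> {2..<?m}" "y = g j" by blast
    then show "x = y" using inj_g[of i j] \<open>weight_space x = weight_space y\<close> by blast
  qed
  have cardH: "card ?H = ?m - 2" using \<open>inj_on g {2..<?m}\<close> by (simp add: card_image)
  have H: "rank h = card (UNIV :: 'x set) - 1" "solves h ?E1 \<and> solves h ?E2" if h: "h \<in> ?H" for h
  proof -
    obtain i where i: "2 \<le> i" "i < ?m" "h = g i" using h by auto
    then show "rank h = card (UNIV :: 'x set) - 1" "solves h ?E1 \<and> solves h ?E2"
      using g(1)[OF i(2)] g(3)[OF i(2) m(1)] g(3)[OF i(2) m(2)] by simp_all
  qed
  have fin: "finite ?H" by simp
  have "card ?H \<le> eq_len ?E1 + eq_len ?E2 \<and> card ?H \<le> 2 * (eq_occ ?E1 k + eq_occ ?E1 l)"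
    by (rule bound[OF fin inj_H H])
  then have part1: "?m \<le> eq_len ?E1 + eq_len ?E2 + 2" "?m \<le> 2 * (eq_occ ?E1 k + eq_occ ?E1 l) + 2"
    using cardH by auto
  \<comment> \<open>A solution of the whole system adds one more weight space to those of
    \<open>?H\<close>, which improves the constant by one.\<close>
  have part2: "?m \<le> eq_len ?E1 + eq_len ?E2 + 1 \<and> ?m \<le> 2 * (eq_occ ?E1 k + eq_occ ?E1 l) + 1"
    if h: "is_solution h (set Es)" "rank h = card (UNIV :: 'x set) - 1" for h :: "'x \<Rightarrow> nat list"
  proof -
    have s: "solves h (Es ! j)" if "j < ?m" for j
      using h(1) nth_mem[OF that] unfolding is_solution_def solves_def by blast
    have "weight_space h \<noteq> weight_space (g j)" if "j \<in> {2..<?m}" for j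
      using weight_space_ne[OF h(2) s[OF m(1)] s that] that by simp
    then have n: "weight_space h \<notin> weight_space ` ?H" by blast
    then have "h \<notin> ?H" by blast
    then have "card (insert h ?H) = ?m - 1" using cardH fin m by (simp add: card_insert_disjoint)
    moreover have "card (insert h ?H) \<le> eq_len ?E1 + eq_len ?E2
        \<and> card (insert h ?H) \<le> 2 * (eq_occ ?E1 k + eq_occ ?E1 l)"
    proof (rule bound)
      show "inj_on weight_space (insert h ?H)" using inj_H n unfolding inj_on_insert by blast
      show "rank h' = card (UNIV :: 'x set) - 1" "solves h' ?E1 \<and> solves h' ?E2"
        if "h' \<in> insert h ?H" for h'
        using that H[of h'] h(2) s[OF m(1)] s[OF m(2)] by blast+
    qed (use fin in simp)
    ultimately show ?thesis by auto
  qed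
  show ?thesis using part1 part2 kl by blast
qed

end
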